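(* Let $p$ be a prime and let $G$ be a finite $p$-group such that $\mathrm{cd}(G)=\{1,m\}$ for some $m>1$. Let $k\ge 1$ be a natural number and let $w_k=[x_1,y_1]\cdots[x_k,y_k]$, a product of $k$ commutators in $2k$ distinct variables. Then $G'=G_{w_k}$ and $|\{N_{w_k}(g) : g\in G'\}|=2$. Furthermore, $N_{w_k}(g)\geq |G|^{2k-1}$ for all $g\in G'$.
   Context: $G'$ denotes the derived (commutator) subgroup of $G$, and $\mathrm{cd}(G)$ denotes the set of degrees $\chi(1)$ of irreducible complex characters $\chi$ of $G$. The word $w_k=[x_1,y_1]\cdots[x_k,y_k]$ is viewed as an element of the free group on the $2k$ variables $x_1,y_1,\ldots,x_k,y_k$, where $[x,y]$ is the group commutator. For a finite group $G$ and $g\in G$, $N_{w_k}(g)$ is the number of $2k$-tuples $(a_1,b_1,\ldots,a_k,b_k)\in G^{2k}$ with $[a_1,b_1]\cdots[a_k,b_k]=g$. The set $G_{w_k}$ of $w_k$-values is the set of all elements of $G$ of the form $[a_1,b_1]\cdots[a_k,b_k]$ with $a_i,b_i\in G$. *)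

theory Defs
  imports
    "HOL-Algebra.Generated_Groups"
    "HOL-Computational_Algebra.Primes"
    "Jordan_Normal_Form.VS_Connect"
    Complex_Main
begin

abbreviation GL_complex :: "nat \<Rightarrow> complex mat monoid" where
  "GL_complex n \<equiv> units_of (ring_mat TYPE(complex) n ())"

definition invariant_subspace ::
  "('a, 'b) monoid_scheme \<Rightarrow> nat \<Rightarrow> ('a \<Rightarrow> complex mat) \<Rightarrow> complex vec set \<Rightarrow> bool" where
  "invariant_subspace G n \<rho> W \<longleftrightarrow>
     VectorSpace.subspace class_ring W (module_vec TYPE(complex) n) \<and>
     (\<forall>g \<in> carrier G. \<forall>v \<in> W. \<rho> g *\<^sub>v v \<in> W)"

definition irreducible_representation ::
  "('a, 'b) monoid_scheme \<Rightarrow> nat \<Rightarrow> ('a \<Rightarrow> complex mat) \<Rightarrow> bool" where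
  "irreducible_representation G n \<rho> \<longleftrightarrow>
     0 < n \<and> \<rho> \<in> hom G (GL_complex n) \<and>
     (\<forall>W. invariant_subspace G n \<rho> W \<longrightarrow> W = {0\<^sub>v n} \<or> W = carrier_vec n)"

definition mat_trace :: "'a::comm_monoid_add mat \<Rightarrow> 'a" where
  "mat_trace A = (\<Sum>i<dim_row A. A $$ (i, i))"

definition irreducible_characters :: "('a, 'b) monoid_scheme \<Rightarrow> ('a \<Rightarrow> complex) set" where
  "irreducible_characters G =
     {\<lambda>g\<in>carrier G. mat_trace (\<rho> g) | \<rho>. \<exists>n. irreducible_representation G n \<rho>}"

definition character_degrees :: "('a, 'b) monoid_scheme \<Rightarrow> complex set" where
  "character_degrees G = (\<lambda>\<chi>. \<chi> \<one>\<^bsub>G\<^esub>) ` irreducible_characters G"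


text \<open>The commutator convention is the one used in \<^const>\<open>derived\<close>.\<close>

definition group_commutator :: "('a, 'b) monoid_scheme \<Rightarrow> 'a \<Rightarrow> 'a \<Rightarrow> 'a" where
  "group_commutator G x y = x \<otimes>\<^bsub>G\<^esub> y \<otimes>\<^bsub>G\<^esub> inv\<^bsub>G\<^esub> x \<otimes>\<^bsub>G\<^esub> inv\<^bsub>G\<^esub> y"

text \<open>A tuple \<open>(a\<^sub>1, b\<^sub>1, \<dots>, a\<^sub>k, b\<^sub>k)\<close> is encoded as the list
  \<open>[(a\<^sub>1, b\<^sub>1), \<dots>, (a\<^sub>k, b\<^sub>k)]\<close> of length \<open>k\<close>.\<close>

definition pair_tuples :: "('a, 'b) monoid_scheme \<Rightarrow> nat \<Rightarrow> ('a \<times> 'a) list set" where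
  "pair_tuples G k = {ps. length ps = k \<and> set ps \<subseteq> carrier G \<times> carrier G}"

definition commutator_product :: "('a, 'b) monoid_scheme \<Rightarrow> ('a \<times> 'a) list \<Rightarrow> 'a" where
  "commutator_product G ps =
     foldr (\<lambda>(a, b) r. group_commutator G a b \<otimes>\<^bsub>G\<^esub> r) ps \<one>\<^bsub>G\<^esub>"

definition commutator_word_count :: "('a, 'b) monoid_scheme \<Rightarrow> nat \<Rightarrow> 'a \<Rightarrow> nat" where
  "commutator_word_count G k g = card {ps \<in> pair_tuples G k. commutator_product G ps = g}"

definition commutator_word_values :: "('a, 'b) monoid_scheme \<Rightarrow> nat \<Rightarrow> 'a set" where
  "commutator_word_values G k = commutator_product G ` pair_tuples G k"

end

theory Submission
  imports Defs "Jordan_Normal_Form.Spectral_Radius" "HOL-Algebra.Group_Action"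
begin

text \<open>Only the degrees 1 and \<open>m\<close> occur, so Frobenius' formula for the number of solutions makes
  \<open>N(g)\<close> constant on the nontrivial elements of \<open>G'\<close>, equal to
  \<open>|G|^(2k-1) |G:G'| (1 - m^(-2k))\<close>, and larger by \<open>(|G|/m)^(2k)\<close> at the identity. Since a nontrivial
  \<open>p\<close>-group is not perfect, \<open>|G:G'| \<ge> 2\<close>, and the bound follows because \<open>m^(2k) \<ge> 2\<close>.

  Neither Maschke's theorem nor the completeness of the irreducible characters is needed for the
  formula: any representation can be made block triangular, so a function on \<open>G\<close> that annihilates
  all irreducible traces annihilates the trace of the regular representation. Applied to all
  translates of the function, this shows that the function vanishes.\<close>

subsection \<open>Matrix representations and Schur's lemma\<close>

text \<open>The irreducible representations are never listed or counted: by Schur's lemma the images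
  of \<open>\<Sum>g. N(g) g\<close> and of the sum over \<open>G'\<close> are scalar matrices that
  depend on the degree alone. Two degrees therefore impose only two linear equations on a
  combination with coefficient \<open>c\<close> on \<open>G'\<close> and an additional
  \<open>b\<close> at the identity, namely \<open>c |G'| + b = |G|^(2k)\<close> in degree 1 and
  \<open>b = (|G|/m)^(2k)\<close> in degree \<open>m\<close>. The lower bound rests on
  \<open>c\<close> alone: if \<open>G'\<close> were all of \<open>G\<close>, then \<open>c\<close>
  would fall short of \<open>|G|^(2k-1)\<close> by the factor \<open>1 - m^(-2k)\<close>, so a
  purely group-theoretic argument has to exclude this case.\<close>

lemma hom_GL_complexI:
  fixes G (structure)
  assumes "group G"
    and carr: "\<And>g. g \<in> carrier G \<Longrightarrow> \<rho> g \<in> carrier_mat n n"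
    and mult: "\<And>g h. g \<in> carrier G \<Longrightarrow> h \<in> carrier G \<Longrightarrow> \<rho> (g \<otimes> h) = \<rho> g * \<rho> h"
    and one: "\<rho> \<one> = 1\<^sub>m n"
  shows "\<rho> \<in> hom G (GL_complex n)"
proof -
  interpret group G by fact
  have "\<rho> g \<in> Units (ring_mat TYPE(complex) n ())" if g: "g \<in> carrier G" for g
  proof -
    have "\<rho> g * \<rho> (inv g) = 1\<^sub>m n" "\<rho> (inv g) * \<rho> g = 1\<^sub>m n"
      using g one by (simp_all flip: mult)
    then show ?thesis
      using g carr by (auto simp: Units_def ring_mat_simps)
  qed
  then show ?thesis
    by (auto simp: hom_def units_of_def ring_mat_simps mult)
qed

lemma (in group) hom_GL_complex_one:
  assumes "\<rho> \<in> hom G (GL_complex n)"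
  shows "\<rho> \<one> = 1\<^sub>m n"
proof -
  have "group (GL_complex n)"
    by (intro monoid.units_group ring.is_monoid ring_mat)
  then have "\<rho> \<one> = \<one>\<^bsub>GL_complex n\<^esub>"
    using assms by (intro hom_one is_group)
  then show ?thesis
    by (simp add: units_of_def ring_mat_simps)
qed

locale matrix_representation = group G for G (structure) +
  fixes n :: nat and \<rho> :: "'a \<Rightarrow> complex mat"
  assumes fin: "finite (carrier G)"
    and hom: "\<rho> \<in> hom G (GL_complex n)"
begin

lemma carr [simp]: "g \<in> carrier G \<Longrightarrow> \<rho> g \<in> carrier_mat n n"
  using hom by (auto simp: hom_def units_of_def Units_def ring_mat_simps)

lemma dims [simp]:
  "g \<in> carrier G \<Longrightarrow> dim_row (\<rho> g) = n" "g \<in> carrier G \<Longrightarrow> dim_col (\<rho> g) = n"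
  using carr by blast+

lemma mult: "g \<in> carrier G \<Longrightarrow> h \<in> carrier G \<Longrightarrow> \<rho> (g \<otimes> h) = \<rho> g * \<rho> h"
  using hom by (auto simp: hom_def units_of_def ring_mat_simps)

lemma one: "\<rho> \<one> = 1\<^sub>m n"
  by (rule hom_GL_complex_one[OF hom])

lemma mult_index:
  assumes "g \<in> carrier G" "h \<in> carrier G" "i < n" "j < n"
  shows "\<rho> (g \<otimes> h) $$ (i, j) = (\<Sum>k<n. \<rho> g $$ (i, k) * \<rho> h $$ (k, j))"
  using assms by (simp add: mult scalar_prod_def atLeast0LessThan)

lemma one_index: "i < n \<Longrightarrow> j < n \<Longrightarrow> \<rho> \<one> $$ (i, j) = (if i = j then 1 else 0)"
  by (simp add: one)

end

lemma subspace_module_vecI: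
  assumes "W \<subseteq> carrier_vec n" "0\<^sub>v n \<in> W"
    and "\<And>v w. v \<in> W \<Longrightarrow> w \<in> W \<Longrightarrow> v + w \<in> W"
    and "\<And>c v. v \<in> W \<Longrightarrow> c \<cdot>\<^sub>v v \<in> W"
  shows "VectorSpace.subspace class_ring W (module_vec TYPE('f :: field) n)"
  unfolding VectorSpace.subspace_def submodule_def
  using assms vec_vs vec_module by (auto simp: module_vec_simps)

locale irreducible_matrix_representation = matrix_representation +
  assumes irred: "irreducible_representation G n \<rho>"
begin

lemma n_pos: "0 < n"
  using irred by (simp add: irreducible_representation_def)

text \<open>Over the complex numbers \<open>M\<close> has an eigenvalue. Since \<open>M\<close>
  commutes with the action, its eigenspace is invariant and, being nonzero, is the whole
  space.\<close>

lemma schur: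
  assumes M: "M \<in> carrier_mat n n"
    and comm: "\<And>g. g \<in> carrier G \<Longrightarrow> \<rho> g * M = M * \<rho> g"
  shows "\<exists>c. M = c \<cdot>\<^sub>m 1\<^sub>m n"
proof -
  obtain c where "c \<in> spectrum M"
    using spectrum_non_empty[OF M n_pos] by blast
  then obtain v where v: "v \<in> carrier_vec n" "v \<noteq> 0\<^sub>v n" "M *\<^sub>v v = c \<cdot>\<^sub>v v"
    using M by (auto simp: spectrum_def eigenvalue_def eigenvector_def)
  define W where "W = {w \<in> carrier_vec n. M *\<^sub>v w = c \<cdot>\<^sub>v w}"
  have "VectorSpace.subspace class_ring W (module_vec TYPE(complex) n)"
  proof (rule subspace_module_vecI)
    show "W \<subseteq> carrier_vec n" by (auto simp: W_def)
    show "0\<^sub>v n \<in> W" using M by (auto simp: W_def)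
    show "u + w \<in> W" if "u \<in> W" "w \<in> W" for u w
      using that M by (simp add: W_def mult_add_distrib_mat_vec smult_add_distrib_vec[of _ n])
    show "a \<cdot>\<^sub>v w \<in> W" if "w \<in> W" for a w
    proof -
      have "M *\<^sub>v (a \<cdot>\<^sub>v w) = a \<cdot>\<^sub>v (c \<cdot>\<^sub>v w)"
        using that M by (simp add: W_def mult_mat_vec)
      then show ?thesis
        using that by (simp add: W_def smult_smult_assoc mult.commute)
    qed
  qed
  moreover have "\<rho> g *\<^sub>v w \<in> W" if "g \<in> carrier G" "w \<in> W" for g w
  proof -
    have w: "w \<in> carrier_vec n" "M *\<^sub>v w = c \<cdot>\<^sub>v w"
      using that by (auto simp: W_def)
    have g: "\<rho> g \<in> carrier_mat n n" using that by simp
    have "M *\<^sub>v (\<rho> g *\<^sub>v w) = \<rho> g *\<^sub>v (M *\<^sub>v w)"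
      using M g w(1) comm[OF that(1)] by (metis assoc_mult_mat_vec)
    also have "\<dots> = c \<cdot>\<^sub>v (\<rho> g *\<^sub>v w)"
      using g w by (simp add: mult_mat_vec)
    finally show ?thesis
      using g w(1) by (auto simp: W_def)
  qed
  ultimately have "W = {0\<^sub>v n} \<or> W = carrier_vec n"
    using irred by (auto simp: irreducible_representation_def invariant_subspace_def)
  then have W: "W = carrier_vec n"
    using v by (auto simp: W_def)
  have "M = c \<cdot>\<^sub>m 1\<^sub>m n"
  proof (rule eq_matI)
    fix i j assume "i < dim_row (c \<cdot>\<^sub>m 1\<^sub>m n :: complex mat)" "j < dim_col (c \<cdot>\<^sub>m 1\<^sub>m n :: complex mat)"
    then have ij: "i < n" "j < n" by auto
    have "unit_vec n j \<in> W" by (simp add: W)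
    then have "M *\<^sub>v unit_vec n j = c \<cdot>\<^sub>v unit_vec n j"
      by (simp add: W_def)
    then have "(M *\<^sub>v unit_vec n j) $ i = (c \<cdot>\<^sub>v unit_vec n j) $ i" by simp
    then show "M $$ (i, j) = (c \<cdot>\<^sub>m 1\<^sub>m n) $$ (i, j)"
      using ij M by simp
  qed (use M in auto)
  then show ?thesis ..
qed

text \<open>Comparing traces identifies the scalar in Schur's lemma, so that a single entry of a
  commuting matrix can be computed from its trace.\<close>

lemma schur_trace:
  assumes M: "M \<in> carrier_mat n n"
    and comm: "\<And>g. g \<in> carrier G \<Longrightarrow> \<rho> g * M = M * \<rho> g"
    and ij: "i < n" "j < n"
  shows "M $$ (i, j) = (if i = j then (\<Sum>k<n. M $$ (k, k)) / of_nat n else 0)"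
proof -
  obtain c where c: "M = c \<cdot>\<^sub>m 1\<^sub>m n"
    using schur[OF M comm] by blast
  then show ?thesis
    using ij n_pos by simp
qed

text \<open>Each \<open>\<rho> g\<close> commutes with all the others and so is scalar by Schur's
  lemma. Hence every subspace is invariant, in particular the line \<open>W\<close> through the
  first unit vector, which must then be the whole space.\<close>

lemma dim_eq_1_if_commuting:
  assumes comm: "\<And>g h. g \<in> carrier G \<Longrightarrow> h \<in> carrier G \<Longrightarrow> \<rho> g * \<rho> h = \<rho> h * \<rho> g"
  shows "n = 1"
proof -
  define W where "W = {w \<in> carrier_vec n :: complex vec set. \<forall>i<n. 0 < i \<longrightarrow> w $ i = 0}"
  have "VectorSpace.subspace class_ring W (module_vec TYPE(complex) n)"
    unfolding W_def by (intro subspace_module_vecI) auto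
  moreover have "\<rho> g *\<^sub>v w \<in> W" if "g \<in> carrier G" "w \<in> W" for g w
  proof -
    have "\<exists>c. \<rho> g = c \<cdot>\<^sub>m 1\<^sub>m n"
      using that by (intro schur comm) auto
    then obtain c where "\<rho> g = c \<cdot>\<^sub>m 1\<^sub>m n" ..
    then have "\<rho> g *\<^sub>v w = c \<cdot>\<^sub>v w"
      using that by (auto simp: W_def)
    then show ?thesis
      using that by (auto simp: W_def)
  qed
  ultimately have "W = {0\<^sub>v n} \<or> W = carrier_vec n"
    using irred by (auto simp: irreducible_representation_def invariant_subspace_def)
  moreover have "unit_vec n 0 \<in> W" "unit_vec n 0 \<noteq> (0\<^sub>v n :: complex vec)"
    using n_pos by (auto simp: W_def)
  ultimately have W: "W = carrier_vec n" by auto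
  show ?thesis
  proof (rule ccontr)
    assume "n \<noteq> 1"
    with n_pos have "1 < n" by simp
    then have "unit_vec n 1 \<notin> W" by (auto simp: W_def intro!: exI[of _ 1])
    with W show False by simp
  qed
qed

end

subsection \<open>Commutators and commutator words\<close>

lemma (in group) sum_carrier_left_mult:
  assumes "h \<in> carrier G"
  shows "(\<Sum>g\<in>carrier G. f (h \<otimes> g)) = (\<Sum>g\<in>carrier G. f g)"
proof (rule sum.reindex_bij_witness[where i = "\<lambda>g. inv h \<otimes> g" and j = "\<lambda>g. h \<otimes> g"])
  fix g assume "g \<in> carrier G"
  then show "inv h \<otimes> (h \<otimes> g) = g" "h \<otimes> (inv h \<otimes> g) = g"
    using assms by (simp_all flip: m_assoc)
qed (use assms in auto)

lemma (in group) sum_carrier_right_mult: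
  assumes "h \<in> carrier G"
  shows "(\<Sum>g\<in>carrier G. f (g \<otimes> h)) = (\<Sum>g\<in>carrier G. f g)"
  by (rule sum.reindex_bij_witness[where i = "\<lambda>g. g \<otimes> inv h" and j = "\<lambda>g. g \<otimes> h"])
    (use assms in \<open>auto simp: m_assoc\<close>)

lemma (in group) group_commutator_closed [simp]:
  "a \<in> carrier G \<Longrightarrow> b \<in> carrier G \<Longrightarrow> group_commutator G a b \<in> carrier G"
  by (simp add: group_commutator_def)

lemma (in group) group_commutator_mult_swap:
  assumes "a \<in> carrier G" "b \<in> carrier G"
  shows "group_commutator G a b \<otimes> (b \<otimes> a) = a \<otimes> b"
proof -
  have "group_commutator G a b \<otimes> (b \<otimes> a) = a \<otimes> b \<otimes> (inv a \<otimes> (inv b \<otimes> b) \<otimes> a)"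
    unfolding group_commutator_def using assms by (simp only: m_assoc m_closed inv_closed)
  also have "\<dots> = a \<otimes> b" using assms by simp
  finally show ?thesis .
qed

lemma (in group) derived_carrier_eq:
  "derived G (carrier G) = generate G {group_commutator G a b | a b. a \<in> carrier G \<and> b \<in> carrier G}"
proof -
  have "derived_set G (carrier G) = {group_commutator G a b | a b. a \<in> carrier G \<and> b \<in> carrier G}"
    by (auto simp: group_commutator_def)
  then show ?thesis by (simp add: derived_def)
qed

lemma (in group) group_commutator_in_derived:
  "a \<in> carrier G \<Longrightarrow> b \<in> carrier G \<Longrightarrow> group_commutator G a b \<in> derived G (carrier G)"
  unfolding derived_carrier_eq by (rule generate.incl) auto

lemma (in group) derived_subset_if_commutators:
  assumes "subgroup H G"
    and "\<And>a b. a \<in> carrier G \<Longrightarrow> b \<in> carrier G \<Longrightarrow> group_commutator G a b \<in> H"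
  shows "derived G (carrier G) \<subseteq> H"
  unfolding derived_carrier_eq using assms by (intro generate_subgroup_incl) auto

lemma pair_tuples_0 [simp]: "pair_tuples G 0 = {[]}"
  by (auto simp: pair_tuples_def)

lemma pair_tuples_Suc:
  "pair_tuples G (Suc k) = (\<lambda>(x, ps). x # ps) ` ((carrier G \<times> carrier G) \<times> pair_tuples G k)"
  by (auto simp: pair_tuples_def length_Suc_conv image_iff)

lemma finite_pair_tuples: "finite (carrier G) \<Longrightarrow> finite (pair_tuples G k)"
  by (induction k) (auto simp: pair_tuples_Suc)

lemma sum_pair_tuples_Suc:
  "(\<Sum>ps\<in>pair_tuples G (Suc k). f ps) =
    (\<Sum>a\<in>carrier G. \<Sum>b\<in>carrier G. \<Sum>ps\<in>pair_tuples G k. f ((a, b) # ps))"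
proof -
  have inj: "inj_on (\<lambda>(x, ps). x # ps) ((carrier G \<times> carrier G) \<times> pair_tuples G k)"
    by (auto simp: inj_on_def)
  define F where "F x = (\<Sum>ps\<in>pair_tuples G k. f (x # ps))" for x
  have "(\<Sum>ps\<in>pair_tuples G (Suc k). f ps) = (\<Sum>x\<in>carrier G \<times> carrier G. F x)"
    using inj by (simp add: F_def pair_tuples_Suc sum.reindex sum.cartesian_product case_prod_unfold)
  also have "\<dots> = (\<Sum>a\<in>carrier G. \<Sum>b\<in>carrier G. F (a, b))"
    by (simp add: sum.cartesian_product case_prod_unfold)
  finally show ?thesis by (simp add: F_def)
qed

lemma commutator_product_simps [simp]:
  "commutator_product G [] = \<one>\<^bsub>G\<^esub>"
  "commutator_product G ((a, b) # ps) = group_commutator G a b \<otimes>\<^bsub>G\<^esub> commutator_product G ps"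
  by (simp_all add: commutator_product_def)

lemma (in group) commutator_product_closed:
  "ps \<in> pair_tuples G k \<Longrightarrow> commutator_product G ps \<in> carrier G"
  by (induction k arbitrary: ps) (auto simp: pair_tuples_Suc)

lemma (in group) commutator_product_in_derived:
  "ps \<in> pair_tuples G k \<Longrightarrow> commutator_product G ps \<in> derived G (carrier G)"
proof (induction k arbitrary: ps)
  case 0
  then show ?case
    by (simp add: derived_def generate.one)
next
  case (Suc k)
  then show ?case
    by (auto simp: pair_tuples_Suc
        intro!: subgroup.m_closed[OF derived_is_subgroup[OF order.refl]] group_commutator_in_derived)
qed

text \<open>This turns sums weighted by the counts into sums over tuples, where induction on
  \<open>k\<close> is possible.\<close>

lemma (in group) sum_commutator_word_count:
  fixes f :: "'a \<Rightarrow> 'c :: comm_semiring_1"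
  assumes fin: "finite (carrier G)"
  shows "(\<Sum>g\<in>carrier G. of_nat (commutator_word_count G k g) * f g) =
    (\<Sum>ps\<in>pair_tuples G k. f (commutator_product G ps))"
proof -
  have "(\<Sum>ps\<in>pair_tuples G k. f (commutator_product G ps)) =
      (\<Sum>g\<in>carrier G. \<Sum>ps\<in>{ps \<in> pair_tuples G k. commutator_product G ps = g}. f (commutator_product G ps))"
    by (rule sum.group[symmetric])
      (use fin in \<open>auto simp: finite_pair_tuples intro: commutator_product_closed\<close>)
  also have "\<dots> = (\<Sum>g\<in>carrier G. of_nat (commutator_word_count G k g) * f g)"
    by (simp add: commutator_word_count_def)
  finally show ?thesis ..
qed

lemma (in matrix_representation) trace_eq:
  "g \<in> carrier G \<Longrightarrow> mat_trace (\<rho> g) = (\<Sum>i<n. \<rho> g $$ (i, i))"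
  by (simp add: mat_trace_def)

subsection \<open>Schur orthogonality and sums of commutators\<close>

context irreducible_matrix_representation
begin

text \<open>For fixed \<open>j\<close> and \<open>k\<close> the entries over \<open>i\<close> and
  \<open>l\<close> form the matrix \<open>\<Sum>b. \<rho> b * E * \<rho> (inv b)\<close> with
  \<open>E\<close> the elementary matrix at \<open>(j, k)\<close>. Averaging makes it commute with
  the action, so Schur's lemma leaves only its trace to be found. With \<open>inv b\<close> in place
  of complex conjugation the relation holds in any basis.\<close>

lemma schur_orthogonality:
  assumes "i < n" "j < n" "k < n" "l < n"
  shows "(\<Sum>b\<in>carrier G. \<rho> b $$ (i, j) * \<rho> (inv b) $$ (k, l)) =
    (if j = k \<and> i = l then of_nat (card (carrier G)) / of_nat n else 0)"
proof -
  define X where "X = mat n n (\<lambda>(i, l). \<Sum>b\<in>carrier G. \<rho> b $$ (i, j) * \<rho> (inv b) $$ (k, l))"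
  have X: "X \<in> carrier_mat n n" by (simp add: X_def)
  have comm: "\<rho> h * X = X * \<rho> h" if h: "h \<in> carrier G" for h
  proof (rule eq_matI)
    fix i l assume "i < dim_row (X * \<rho> h)" "l < dim_col (X * \<rho> h)"
    then have il: "i < n" "l < n" using X h by auto
    have "(\<rho> h * X) $$ (i, l) =
        (\<Sum>t<n. \<rho> h $$ (i, t) * (\<Sum>b\<in>carrier G. \<rho> b $$ (t, j) * \<rho> (inv b) $$ (k, l)))"
      using il h X by (simp add: scalar_prod_def X_def atLeast0LessThan)
    also have "\<dots> = (\<Sum>b\<in>carrier G. \<Sum>t<n. \<rho> h $$ (i, t) * \<rho> b $$ (t, j) * \<rho> (inv b) $$ (k, l))"
      unfolding sum_distrib_left mult.assoc by (rule sum.swap)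
    also have "\<dots> = (\<Sum>b\<in>carrier G. \<rho> (h \<otimes> b) $$ (i, j) * \<rho> (inv b) $$ (k, l))"
      using assms il h by (intro sum.cong refl) (simp add: mult_index sum_distrib_right)
    \<comment> \<open>The factor \<open>h\<close> is inserted so that \<open>b\<close> occurs only
      through \<open>h \<otimes> b\<close> and the sum can be translated.\<close>
    also have "\<dots> = (\<Sum>b\<in>carrier G. \<rho> (h \<otimes> b) $$ (i, j) * \<rho> (inv (h \<otimes> b) \<otimes> h) $$ (k, l))"
      using h by (intro sum.cong refl) (simp add: inv_mult_group m_assoc)
    also have "\<dots> = (\<Sum>b\<in>carrier G. \<rho> b $$ (i, j) * \<rho> (inv b \<otimes> h) $$ (k, l))"
      by (rule sum_carrier_left_mult[OF h])
    also have "\<dots> = (\<Sum>b\<in>carrier G. \<Sum>t<n. \<rho> b $$ (i, j) * \<rho> (inv b) $$ (k, t) * \<rho> h $$ (t, l))"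
      using assms il h by (intro sum.cong refl) (simp add: mult_index sum_distrib_left mult.assoc)
    also have "\<dots> = (\<Sum>t<n. (\<Sum>b\<in>carrier G. \<rho> b $$ (i, j) * \<rho> (inv b) $$ (k, t)) * \<rho> h $$ (t, l))"
      unfolding sum_distrib_right by (rule sum.swap)
    also have "\<dots> = (X * \<rho> h) $$ (i, l)"
      using il h X by (simp add: scalar_prod_def X_def atLeast0LessThan)
    finally show "(\<rho> h * X) $$ (i, l) = (X * \<rho> h) $$ (i, l)" .
  qed (use X h in auto)
  \<comment> \<open>In the trace the two outer indices are contracted and the group elements cancel
    to \<open>\<one>\<close>, so every \<open>b\<close> contributes the same Kronecker
    delta.\<close>
  have "(\<Sum>s<n. X $$ (s, s)) = (\<Sum>b\<in>carrier G. \<Sum>s<n. \<rho> (inv b) $$ (k, s) * \<rho> b $$ (s, j))"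
    by (simp add: X_def mult.commute sum.swap[of _ "carrier G"])
  also have "\<dots> = (\<Sum>b\<in>carrier G. \<rho> (inv b \<otimes> b) $$ (k, j))"
    using assms by (intro sum.cong refl) (simp flip: mult_index)
  also have "\<dots> = (if j = k then of_nat (card (carrier G)) else 0)"
    using assms by (simp add: one_index)
  finally have "X $$ (i, l) =
      (if j = k \<and> i = l then of_nat (card (carrier G)) / of_nat n else 0)"
    using schur_trace[OF X comm \<open>i < n\<close> \<open>l < n\<close>] by simp
  then show ?thesis
    using assms by (simp add: X_def)
qed

text \<open>Orthogonality is used twice: the sum over \<open>a\<close> turns
  \<open>\<rho> a * \<rho> b * \<rho> (inv a)\<close> into the scalar \<open>|G| / n\<close> times
  the trace of \<open>\<rho> b\<close>, and the sum over \<open>b\<close> of that trace times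
  \<open>\<rho> (inv b)\<close> gives the second factor \<open>|G| / n\<close>.\<close>

lemma sum_group_commutator:
  assumes "i < n" "j < n"
  shows "(\<Sum>a\<in>carrier G. \<Sum>b\<in>carrier G. \<rho> (group_commutator G a b) $$ (i, j)) =
    (if i = j then (of_nat (card (carrier G)) / of_nat n)\<^sup>2 else 0)"
proof -
  define c :: complex where "c = of_nat (card (carrier G)) / of_nat n"
  \<comment> \<open>The four factors are grouped by variable, so that those of \<open>a\<close> form
    one instance of orthogonality with coefficients depending on \<open>b\<close>.\<close>
  have expand: "\<rho> (group_commutator G a b) $$ (i, j) =
      (\<Sum>u<n. \<Sum>t<n. \<Sum>s<n.
        \<rho> b $$ (s, t) * \<rho> (inv b) $$ (u, j) * (\<rho> a $$ (i, s) * \<rho> (inv a) $$ (t, u)))"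
    if "a \<in> carrier G" "b \<in> carrier G" for a b
    using that assms
    by (simp add: group_commutator_def mult_index sum_distrib_left sum_distrib_right mult_ac)
  have inner: "(\<Sum>a\<in>carrier G. \<rho> (group_commutator G a b) $$ (i, j)) =
      (\<Sum>s<n. c * (\<rho> b $$ (s, s) * \<rho> (inv b) $$ (i, j)))" if b: "b \<in> carrier G" for b
  proof -
    have "(\<Sum>a\<in>carrier G. \<rho> (group_commutator G a b) $$ (i, j)) =
        (\<Sum>u<n. \<Sum>t<n. \<Sum>s<n. \<rho> b $$ (s, t) * \<rho> (inv b) $$ (u, j) *
          (\<Sum>a\<in>carrier G. \<rho> a $$ (i, s) * \<rho> (inv a) $$ (t, u)))"
      using b by (simp add: expand sum.swap[of _ "carrier G"] sum_distrib_left)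
    also have "\<dots> = (\<Sum>u<n. \<Sum>t<n. \<Sum>s<n.
        (if s = t then (if i = u then c * (\<rho> b $$ (s, t) * \<rho> (inv b) $$ (u, j)) else 0) else 0))"
      using assms by (intro sum.cong refl) (auto simp: schur_orthogonality c_def)
    also have "\<dots> = (\<Sum>u<n. \<Sum>t<n. if i = u then c * (\<rho> b $$ (t, t) * \<rho> (inv b) $$ (u, j)) else 0)"
      by (intro sum.cong refl) (simp add: sum.delta)
    also have "\<dots> = (\<Sum>t<n. \<Sum>u<n. if i = u then c * (\<rho> b $$ (t, t) * \<rho> (inv b) $$ (u, j)) else 0)"
      by (rule sum.swap)
    also have "\<dots> = (\<Sum>s<n. c * (\<rho> b $$ (s, s) * \<rho> (inv b) $$ (i, j)))"
      using assms by (simp add: sum.delta')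
    finally show ?thesis .
  qed
  have "(\<Sum>a\<in>carrier G. \<Sum>b\<in>carrier G. \<rho> (group_commutator G a b) $$ (i, j)) =
      (\<Sum>b\<in>carrier G. \<Sum>s<n. c * (\<rho> b $$ (s, s) * \<rho> (inv b) $$ (i, j)))"
    by (subst sum.swap) (simp add: inner)
  also have "\<dots> = (\<Sum>s<n. c * (\<Sum>b\<in>carrier G. \<rho> b $$ (s, s) * \<rho> (inv b) $$ (i, j)))"
    by (simp add: sum.swap[of _ "carrier G"] sum_distrib_left)
  also have "\<dots> = (\<Sum>s<n. if s = i then (if i = j then c\<^sup>2 else 0) else 0)"
    using assms by (intro sum.cong refl) (auto simp: schur_orthogonality c_def power2_eq_square)
  also have "\<dots> = (if i = j then c\<^sup>2 else 0)"
    using assms by (simp add: sum.delta)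
  finally show ?thesis by (simp add: c_def)
qed

text \<open>Each commutator contributes the scalar of \<open>sum_group_commutator\<close>, whence
  the exponent \<open>2 * k\<close>. The translate by \<open>h\<close> is carried along for the
  final vanishing test. Only the row index \<open>i\<close> varies in the induction, since
  commutators are split off on the left.\<close>

lemma sum_commutator_product_index:
  assumes h: "h \<in> carrier G" and ij: "i < n" "j < n"
  shows "(\<Sum>ps\<in>pair_tuples G k. \<rho> (commutator_product G ps \<otimes> h) $$ (i, j)) =
    (of_nat (card (carrier G)) / of_nat n) ^ (2 * k) * \<rho> h $$ (i, j)"
  using ij(1)
proof (induction k arbitrary: i)
  case 0
  with h show ?case by simp
next
  case (Suc k)
  define c :: complex where "c = of_nat (card (carrier G)) / of_nat n"
  have "(\<Sum>ps\<in>pair_tuples G (Suc k). \<rho> (commutator_product G ps \<otimes> h) $$ (i, j)) =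
      (\<Sum>a\<in>carrier G. \<Sum>b\<in>carrier G. \<Sum>ps\<in>pair_tuples G k. \<Sum>s<n.
        \<rho> (group_commutator G a b) $$ (i, s) * \<rho> (commutator_product G ps \<otimes> h) $$ (s, j))"
    unfolding sum_pair_tuples_Suc
  proof (intro sum.cong refl)
    fix a b ps assume "a \<in> carrier G" "b \<in> carrier G" "ps \<in> pair_tuples G k"
    then show "\<rho> (commutator_product G ((a, b) # ps) \<otimes> h) $$ (i, j) =
        (\<Sum>s<n. \<rho> (group_commutator G a b) $$ (i, s) * \<rho> (commutator_product G ps \<otimes> h) $$ (s, j))"
      using commutator_product_closed Suc.prems ij h by (simp add: m_assoc mult_index)
  qed
  also have "\<dots> = (\<Sum>s<n. (\<Sum>a\<in>carrier G. \<Sum>b\<in>carrier G. \<rho> (group_commutator G a b) $$ (i, s)) *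
      (\<Sum>ps\<in>pair_tuples G k. \<rho> (commutator_product G ps \<otimes> h) $$ (s, j)))"
    by (simp only: sum.swap[of _ "{..<n}"] sum_distrib_right) (simp only: sum_distrib_left)
  also have "\<dots> = (\<Sum>s<n. if i = s then c ^ (2 * Suc k) * \<rho> h $$ (s, j) else 0)"
    using Suc.prems
    by (intro sum.cong refl) (auto simp: sum_group_commutator Suc.IH c_def power2_eq_square)
  also have "\<dots> = c ^ (2 * Suc k) * \<rho> h $$ (i, j)"
    using Suc.prems by (simp add: sum.delta')
  finally show ?case by (simp add: c_def)
qed

text \<open>This ties degree 1 to \<open>G'\<close>. If \<open>G'\<close> acts trivially, all
  matrices commute and Schur's lemma applies; conversely 1 by 1 matrices commute, so the kernel
  contains all commutators.\<close>

lemma trivial_on_derived_iff: "(\<forall>x\<in>derived G (carrier G). \<rho> x = 1\<^sub>m n) \<longleftrightarrow> n = 1"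
proof
  assume triv: "\<forall>x\<in>derived G (carrier G). \<rho> x = 1\<^sub>m n"
  show "n = 1"
  proof (rule dim_eq_1_if_commuting)
    fix a b assume ab: "a \<in> carrier G" "b \<in> carrier G"
    then have "\<rho> (a \<otimes> b) = \<rho> (group_commutator G a b) * \<rho> (b \<otimes> a)"
      by (simp flip: mult add: group_commutator_mult_swap)
    also have "\<dots> = \<rho> (b \<otimes> a)"
      using ab triv group_commutator_in_derived left_mult_one_mat[OF carr, of "b \<otimes> a"] by simp
    finally show "\<rho> a * \<rho> b = \<rho> b * \<rho> a"
      using ab by (simp add: mult)
  qed
next
  assume n: "n = 1"
  have comm: "\<rho> a * \<rho> b = \<rho> b * \<rho> a" if "a \<in> carrier G" "b \<in> carrier G" for a b
    using that n by (intro eq_matI) (auto simp: scalar_prod_def)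
  have "subgroup {x \<in> carrier G. \<rho> x = 1\<^sub>m n} G"
  proof (rule subgroupI)
    fix x assume x: "x \<in> {x \<in> carrier G. \<rho> x = 1\<^sub>m n}"
    then have "\<rho> (inv x) = \<rho> x * \<rho> (inv x)"
      using left_mult_one_mat[OF carr, of "inv x"] by simp
    also have "\<dots> = \<rho> (x \<otimes> inv x)"
      by (rule mult[symmetric]) (use x in auto)
    also have "\<dots> = 1\<^sub>m n"
      using x one by simp
    finally show "inv x \<in> {x \<in> carrier G. \<rho> x = 1\<^sub>m n}"
      using x by simp
  qed (auto simp: one mult)
  moreover have "\<rho> (group_commutator G a b) = 1\<^sub>m n" if ab: "a \<in> carrier G" "b \<in> carrier G" for a b
  proof -
    have "\<rho> (group_commutator G a b) = \<rho> (a \<otimes> b \<otimes> inv a) * \<rho> (inv b)"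
      using ab by (simp add: group_commutator_def mult)
    also have "\<dots> = \<rho> (a \<otimes> (b \<otimes> inv a)) * \<rho> (inv b)"
      using ab by (simp add: m_assoc)
    also have "\<dots> = \<rho> ((b \<otimes> inv a) \<otimes> a \<otimes> inv b)"
      using ab comm[of a "b \<otimes> inv a"] by (simp only: mult m_closed inv_closed)
    also have "\<dots> = 1\<^sub>m n"
      using ab by (simp add: m_assoc one)
    finally show ?thesis .
  qed
  ultimately have "derived G (carrier G) \<subseteq> {x \<in> carrier G. \<rho> x = 1\<^sub>m n}"
    by (intro derived_subset_if_commutators) auto
  then show "\<forall>x\<in>derived G (carrier G). \<rho> x = 1\<^sub>m n" by auto
qed

text \<open>Normality of \<open>G'\<close> makes \<open>P\<close>, the sum of the matrices over
  \<open>G'\<close>, commute with the action, hence a scalar matrix. For \<open>x\<close> in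
  \<open>G'\<close> multiplication by \<open>\<rho> x\<close> fixes \<open>P\<close>, so a nonzero
  scalar forces \<open>\<rho> x\<close> to be the identity, which happens throughout
  \<open>G'\<close> only in degree 1.\<close>

lemma sum_derived_index:
  assumes h: "h \<in> carrier G" and ij: "i < n" "j < n"
  shows "(\<Sum>x\<in>derived G (carrier G). \<rho> (x \<otimes> h) $$ (i, j)) =
    (if n = 1 then of_nat (card (derived G (carrier G))) * \<rho> h $$ (i, j) else 0)"
proof -
  define D where "D = derived G (carrier G)"
  interpret D: normal D G
    unfolding D_def by (rule derived_self_is_normal)
  define P where "P = mat n n (\<lambda>(i, j). \<Sum>x\<in>D. \<rho> x $$ (i, j))"
  have P: "P \<in> carrier_mat n n" by (simp add: P_def)
  have left: "(\<rho> g * P) $$ (i, j) = (\<Sum>x\<in>D. \<rho> (g \<otimes> x) $$ (i, j))"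
    if "g \<in> carrier G" "i < n" "j < n" for g i j
  proof -
    have "(\<rho> g * P) $$ (i, j) = (\<Sum>t<n. \<Sum>x\<in>D. \<rho> g $$ (i, t) * \<rho> x $$ (t, j))"
      using that P by (simp add: scalar_prod_def P_def atLeast0LessThan sum_distrib_left)
    also have "\<dots> = (\<Sum>x\<in>D. \<Sum>t<n. \<rho> g $$ (i, t) * \<rho> x $$ (t, j))"
      by (rule sum.swap)
    finally show ?thesis
      using that D.mem_carrier by (simp add: mult_index)
  qed
  have right: "(P * \<rho> g) $$ (i, j) = (\<Sum>x\<in>D. \<rho> (x \<otimes> g) $$ (i, j))"
    if "g \<in> carrier G" "i < n" "j < n" for g i j
  proof -
    have "(P * \<rho> g) $$ (i, j) = (\<Sum>t<n. \<Sum>x\<in>D. \<rho> x $$ (i, t) * \<rho> g $$ (t, j))"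
      using that P by (simp add: scalar_prod_def P_def atLeast0LessThan sum_distrib_right)
    also have "\<dots> = (\<Sum>x\<in>D. \<Sum>t<n. \<rho> x $$ (i, t) * \<rho> g $$ (t, j))"
      by (rule sum.swap)
    finally show ?thesis
      using that D.mem_carrier by (simp add: mult_index)
  qed
  show ?thesis
  proof (cases "n = 1")
    case True
    then have "\<rho> (x \<otimes> h) = \<rho> h" if "x \<in> D" for x
      using that h trivial_on_derived_iff D.mem_carrier left_mult_one_mat[OF carr[OF h]]
      by (simp add: mult D_def)
    then show ?thesis
      using True by (simp flip: D_def)
  next
    case False
    have comm: "\<rho> g * P = P * \<rho> g" if g: "g \<in> carrier G" for g
    proof (rule eq_matI)
      fix i j assume "i < dim_row (P * \<rho> g)" "j < dim_col (P * \<rho> g)"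
      then have ij: "i < n" "j < n" using P g by auto
      have "(\<Sum>x\<in>D. \<rho> (g \<otimes> x) $$ (i, j)) = (\<Sum>x\<in>D. \<rho> (x \<otimes> g) $$ (i, j))"
      proof (rule sum.reindex_bij_witness[where i = "\<lambda>x. inv g \<otimes> x \<otimes> g"
            and j = "\<lambda>x. g \<otimes> x \<otimes> inv g"])
        fix x assume x: "x \<in> D"
        then have xc: "x \<in> carrier G" by (rule D.mem_carrier)
        show "inv g \<otimes> (g \<otimes> x \<otimes> inv g) \<otimes> g = x" "g \<otimes> (inv g \<otimes> x \<otimes> g) \<otimes> inv g = x"
          using g xc by (simp_all add: m_assoc) (simp_all flip: m_assoc)
        show "g \<otimes> x \<otimes> inv g \<in> D" "inv g \<otimes> x \<otimes> g \<in> D"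
          using g x D.inv_op_closed1 D.inv_op_closed2 by auto
        show "\<rho> (g \<otimes> x \<otimes> inv g \<otimes> g) $$ (i, j) = \<rho> (g \<otimes> x) $$ (i, j)"
          using g xc by (simp add: m_assoc)
      qed
      then show "(\<rho> g * P) $$ (i, j) = (P * \<rho> g) $$ (i, j)"
        using g ij by (simp add: left right)
    qed (use P g in auto)
    obtain c where c: "P = c \<cdot>\<^sub>m 1\<^sub>m n"
      using schur[OF P comm] by blast
    have "c = 0"
    proof (rule ccontr)
      assume "c \<noteq> 0"
      have "\<rho> x = 1\<^sub>m n" if x: "x \<in> D" for x
      proof (rule eq_matI)
        fix i j assume "i < dim_row (1\<^sub>m n :: complex mat)" "j < dim_col (1\<^sub>m n :: complex mat)"
        then have ij: "i < n" "j < n" by auto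
        have xc: "x \<in> carrier G" using x by (rule D.mem_carrier)
        have "(\<rho> x * P) $$ (i, j) = (\<Sum>y\<in>D. \<rho> (x \<otimes> y) $$ (i, j))"
          by (rule left[OF xc ij])
        also have "\<dots> = (\<Sum>y\<in>D. \<rho> y $$ (i, j))"
        proof (rule sum.reindex_bij_witness[where i = "\<lambda>y. inv x \<otimes> y" and j = "\<lambda>y. x \<otimes> y"])
          fix y assume y: "y \<in> D"
          then have "y \<in> carrier G" by (rule D.mem_carrier)
          then show "inv x \<otimes> (x \<otimes> y) = y" "x \<otimes> (inv x \<otimes> y) = y"
            using xc by (simp_all flip: m_assoc)
        qed (use x in auto)
        also have "\<dots> = P $$ (i, j)" using ij by (simp add: P_def)
        finally have "c * \<rho> x $$ (i, j) = c * (1\<^sub>m n) $$ (i, j)"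
          using ij xc right_mult_one_mat[OF carr[OF xc]]
          by (simp add: c mult_smult_distrib[OF carr[OF xc]])
        then show "\<rho> x $$ (i, j) = 1\<^sub>m n $$ (i, j)"
          using \<open>c \<noteq> 0\<close> by simp
      qed (use D.mem_carrier[OF x] in auto)
      then show False
        using False trivial_on_derived_iff by (auto simp: D_def)
    qed
    then have "P = 0\<^sub>m n n"
      using c by (intro eq_matI) auto
    then have "P * \<rho> h = 0\<^sub>m n n"
      using h by simp
    then show ?thesis
      using False right[OF h ij] ij by (simp add: D_def)
  qed
qed

end

subsection \<open>Reduction to irreducible representations\<close>

text \<open>The columns of \<open>P\<close> are a basis of \<open>W\<close> followed by vectors
  completing it to a basis of the whole space, and \<open>d\<close> is the size of the first part.
  Describing \<open>W\<close> in coordinates lets the block shape of an invariant action be read off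
  later.\<close>

lemma (in vec_space) adapted_basis:
  assumes W: "VectorSpace.subspace class_ring W V"
  obtains P Q d where "P \<in> carrier_mat n n" "Q \<in> carrier_mat n n" "P * Q = 1\<^sub>m n" "Q * P = 1\<^sub>m n"
    "W = {P *\<^sub>v u | u. u \<in> carrier_vec n \<and> (\<forall>i<n. d \<le> i \<longrightarrow> u $ i = 0)}"
proof -
  have submod: "submodule class_ring W V"
    using W by (simp add: VectorSpace.subspace_def)
  then have Wc: "W \<subseteq> carrier_vec n"
    by (auto simp: submodule_def)
  have li_empty: "lin_indpt {}" by (simp add: lin_dep_def)
  have bound: "finite S \<and> card S \<le> n" if "S \<subseteq> carrier_vec n" "lin_indpt S" for S
    using li_le_dim[OF fin_dim] that dim_is_n by auto
  \<comment> \<open>Independent sets have at most \<open>n\<close> elements, so a maximal one inside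
    \<open>W\<close> exists. It spans \<open>W\<close>, because a vector of \<open>W\<close> outside
    its span could be adjoined.\<close>
  have "\<exists>A. finite A \<and> maximal A (\<lambda>S. S \<subseteq> W \<and> lin_indpt S)"
    by (rule maximal_exists[of _ n "{}"]) (use bound Wc li_empty in blast)+
  then obtain A where A: "maximal A (\<lambda>S. S \<subseteq> W \<and> lin_indpt S)"
    by blast
  then have AW: "A \<subseteq> W" and liA: "lin_indpt A" by (auto simp: maximal_def)
  then have Ac: "A \<subseteq> carrier_vec n" using Wc by blast
  have finA: "finite A" using bound Ac liA by blast
  have spanA: "span A = W"
  proof
    show "span A \<subseteq> W" using span_is_subset[OF AW submod] .
    show "W \<subseteq> span A"
    proof (rule ccontr)
      assume "\<not> W \<subseteq> span A"
      then obtain w where w: "w \<in> W" "w \<notin> span A" by blast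
      then have "w \<notin> A" using in_own_span Ac by auto
      moreover have "lin_indpt (A \<union> {w})"
        using lin_dep_iff_in_span[OF _ liA, of w] Ac w Wc \<open>w \<notin> A\<close> by auto
      ultimately show False
        using A w AW by (auto simp: maximal_def)
    qed
  qed
  \<comment> \<open>Only sets containing \<open>A\<close> compete here, so the resulting basis
    extends that of \<open>W\<close>.\<close>
  have "\<exists>B. finite B \<and> maximal B (\<lambda>S. A \<subseteq> S \<and> S \<subseteq> carrier_vec n \<and> lin_indpt S)"
    by (rule maximal_exists[of _ n A]) (use bound Ac liA in simp_all)
  then obtain B where B: "maximal B (\<lambda>S. A \<subseteq> S \<and> S \<subseteq> carrier_vec n \<and> lin_indpt S)"
    by blast
  then have AB: "A \<subseteq> B" and Bc: "B \<subseteq> carrier_vec n" and liB: "lin_indpt B"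
    by (auto simp: maximal_def)
  have finB: "finite B" using bound Bc liB by blast
  have "maximal B (\<lambda>S. S \<subseteq> carrier_vec n \<and> lin_indpt S)"
    unfolding maximal_def
  proof (intro conjI allI impI)
    fix S assume "B \<subseteq> S \<and> S \<subseteq> carrier_vec n \<and> lin_indpt S"
    then have "B \<subseteq> S" "A \<subseteq> S" "S \<subseteq> carrier_vec n" "lin_indpt S"
      using AB by auto
    with B show "S = B" unfolding maximal_def by blast
  qed (use Bc liB in auto)
  then have "basis B" by (rule max_li_is_basis)
  then have cardB: "card B = n"
    using dim_basis[OF finB] dim_is_n by simp
  obtain as where as: "set as = A" "distinct as" using finite_distinct_list[OF finA] by blast
  obtain bs where bs: "set bs = B - A" "distinct bs"
    using finite_distinct_list[of "B - A"] finB by blast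
  define vs where "vs = as @ bs"
  define d where "d = length as"
  have vs: "set vs = B" "distinct vs" using as bs AB by (auto simp: vs_def)
  then have len: "length vs = n" using cardB distinct_card by metis
  define P where "P = mat_of_cols n vs"
  have P: "P \<in> carrier_mat n n" using mat_of_cols_carrier(1)[of n vs] len by (simp add: P_def)
  have P_mult: "P *\<^sub>v u = lincomb f B"
    if u: "u \<in> carrier_vec n" and f: "\<And>i. i < n \<Longrightarrow> f (vs ! i) = u $ i" for u f
  proof -
    \<comment> \<open>The product with a matrix of columns is a linear combination whose coefficient
      at \<open>l\<close> adds up over all columns equal to \<open>l\<close>; distinctness of
      \<open>vs\<close> leaves one term.\<close>
    define h where "h l = (\<Sum>i = 0..<length vs. if l = vs ! i then u $ i else 0)" for l
    have "h (vs ! i) = f (vs ! i)" if "i < n" for i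
    proof -
      have "h (vs ! i) = (\<Sum>j = 0..<n. if i = j then u $ j else 0)"
        unfolding h_def len using that len by (intro sum.cong refl) (simp add: nth_eq_iff_index_eq[OF vs(2)])
      then show ?thesis using that f by simp
    qed
    then have h_eq: "h v = f v" if "v \<in> B" for v
      using that vs(1) len by (metis in_set_conv_nth)
    have nth_carrier: "vs ! i \<in> carrier_vec n" if "i < length vs" for i
      using Bc vs(1) nth_mem[OF that] by blast
    have "P *\<^sub>v u = lincomb h (set vs)"
      unfolding P_def h_def by (rule mat_of_cols_mult_as_finsum) (use u len nth_carrier in simp_all)
    also have "\<dots> = lincomb f B"
      unfolding vs(1) by (rule lincomb_cong[OF refl Bc]) (use h_eq in auto)
    finally show ?thesis .
  qed
  \<comment> \<open>A coordinate vector is reread as a function on basis vectors; the index is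
    unique because \<open>vs\<close> is distinct.\<close>
  define coeff where "coeff u v = u $ (THE i. i < n \<and> vs ! i = v)" for u :: "'a vec" and v
  have coeff: "coeff u (vs ! i) = u $ i" if "i < n" for u i
  proof -
    have "(THE j. j < n \<and> vs ! j = vs ! i) = i"
      using that vs(2) len by (intro the_equality) (auto simp: nth_eq_iff_index_eq)
    then show ?thesis by (simp add: coeff_def)
  qed
  \<comment> \<open>A nonzero kernel vector of \<open>P\<close> would be a nontrivial linear
    relation within \<open>B\<close>.\<close>
  have "det P \<noteq> 0"
  proof
    assume "det P = 0"
    then obtain u where u: "u \<in> carrier_vec n" "u \<noteq> 0\<^sub>v n" "P *\<^sub>v u = 0\<^sub>v n"
      using det_0_iff_vec_prod_zero_field[OF P] by blast
    define f where "f = coeff u"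
    have f: "f (vs ! i) = u $ i" if "i < n" for i
      using coeff[OF that] by (simp add: f_def)
    have "lincomb f B = 0\<^sub>v n"
      using P_mult[OF u(1) f] u(3) by simp
    then have "f v = 0" if "v \<in> B" for v
      using liB finB Bc that by (auto simp: lin_dep_def)
    then have "u $ i = 0" if "i < n" for i
      using that f vs(1) len by (metis nth_mem)
    then show False
      using u by (auto simp: vec_eq_iff)
  qed
  then have "P \<in> Units (ring_mat TYPE('a) n ())"
    by (rule det_non_zero_imp_unit[OF P])
  then obtain Q where Q: "Q \<in> carrier_mat n n" "P * Q = 1\<^sub>m n" "Q * P = 1\<^sub>m n"
    by (auto simp: Units_def ring_mat_simps)
  have lincomb_A: "lincomb f B = lincomb f A" if "\<And>v. v \<in> B - A \<Longrightarrow> f v = 0" for f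
  proof -
    have "lincomb f B = lincomb f (B - A) + lincomb f A"
      using lincomb_vec_diff_add[OF Bc AB finB] by simp
    also have "lincomb f (B - A) = 0\<^sub>v n"
      using that Bc by (intro lincomb_zero) auto
    finally show ?thesis
      using lincomb_closed[OF Ac, of f] by simp
  qed
  have early: "vs ! i \<in> A \<longleftrightarrow> i < d" if "i < n" for i
  proof (cases "i < d")
    case True
    then show ?thesis using as(1) nth_mem[of i as] by (simp add: vs_def d_def nth_append)
  next
    case False
    then have "vs ! i = bs ! (i - d)" "i - d < length bs"
      using that len by (auto simp: vs_def d_def nth_append)
    then have "vs ! i \<in> B - A" using bs(1) nth_mem by metis
    then show ?thesis using False by auto
  qed
  have "W = {P *\<^sub>v u | u. u \<in> carrier_vec n \<and> (\<forall>i<n. d \<le> i \<longrightarrow> u $ i = 0)}"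
  proof (intro equalityI subsetI)
    fix w assume "w \<in> W"
    then obtain g where g: "w = lincomb g A"
      using spanA finite_span[OF finA Ac] by auto
    define f where "f v = (if v \<in> A then g v else 0)" for v
    define u where "u = vec n (\<lambda>i. f (vs ! i))"
    have "P *\<^sub>v u = lincomb f B" by (rule P_mult) (auto simp: u_def)
    also have "\<dots> = lincomb f A" by (rule lincomb_A) (auto simp: f_def)
    also have "\<dots> = w" unfolding g by (rule lincomb_cong[OF refl Ac]) (auto simp: f_def)
    finally show "w \<in> {P *\<^sub>v u | u. u \<in> carrier_vec n \<and> (\<forall>i<n. d \<le> i \<longrightarrow> u $ i = 0)}"
      using early by (force simp: u_def f_def)
  next
    fix w assume "w \<in> {P *\<^sub>v u | u. u \<in> carrier_vec n \<and> (\<forall>i<n. d \<le> i \<longrightarrow> u $ i = 0)}"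
    then obtain u where u: "w = P *\<^sub>v u" "u \<in> carrier_vec n" "\<And>i. i < n \<Longrightarrow> d \<le> i \<Longrightarrow> u $ i = 0"
      by blast
    define f where "f = coeff u"
    have f: "f (vs ! i) = u $ i" if "i < n" for i
      using coeff[OF that] by (simp add: f_def)
    have "f v = 0" if "v \<in> B - A" for v
    proof -
      obtain i where "i < n" "v = vs ! i" using \<open>v \<in> B - A\<close> vs(1) len by (metis DiffD1 in_set_conv_nth)
      then show ?thesis using that early f u(3) by auto
    qed
    then have "w = lincomb f A"
      using P_mult[OF u(2) f] lincomb_A u(1) by simp
    then show "w \<in> W"
      using spanA finite_span[OF finA Ac] by auto
  qed
  then show thesis using that P Q by blast
qed

lemma sum_lessThan_split:
  fixes f :: "nat \<Rightarrow> 'a :: comm_monoid_add"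
  assumes "d \<le> n"
  shows "(\<Sum>k<n. f k) = (\<Sum>k<d. f k) + (\<Sum>k<n - d. f (k + d))"
proof -
  have "(\<Sum>k<d + e. f k) = (\<Sum>k<d. f k) + (\<Sum>k<e. f (k + d))" for e
    by (induction e) (simp_all add: add_ac)
  from this[of "n - d"] show ?thesis using assms by simp
qed

text \<open>In a basis adapted to an invariant subspace the lower left block vanishes. The diagonal
  blocks are then multiplicative on their own and carry the whole trace. Both have smaller degree
  because the subspace is proper and nonzero.\<close>

lemma (in matrix_representation) reducible_trace:
  assumes n: "0 < n" and red: "\<not> irreducible_representation G n \<rho>"
  obtains d A D where "d < n" "0 < d" "A \<in> hom G (GL_complex d)" "D \<in> hom G (GL_complex (n - d))"
    "\<And>g. g \<in> carrier G \<Longrightarrow> mat_trace (\<rho> g) = mat_trace (A g) + mat_trace (D g)"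
proof -
  interpret V: vec_space "TYPE(complex)" n .
  obtain W where W: "invariant_subspace G n \<rho> W" "W \<noteq> {0\<^sub>v n}" "W \<noteq> carrier_vec n"
    using red n hom by (auto simp: irreducible_representation_def)
  then have "VectorSpace.subspace class_ring W (module_vec TYPE(complex) n)"
    by (simp add: invariant_subspace_def)
  then obtain P Q d where P: "P \<in> carrier_mat n n" and Q: "Q \<in> carrier_mat n n"
    and PQ: "P * Q = 1\<^sub>m n" and QP: "Q * P = 1\<^sub>m n"
    and W_eq: "W = {P *\<^sub>v u | u. u \<in> carrier_vec n \<and> (\<forall>i<n. d \<le> i \<longrightarrow> u $ i = 0)}"
    by (rule V.adapted_basis[of W]) (rule that)
  \<comment> \<open>\<open>adapted_basis\<close> does not bound \<open>d\<close>; both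
    \<open>0 < d\<close> and \<open>d < n\<close> come from the choice of \<open>W\<close>.\<close>
  have d_pos: "0 < d"
  proof (rule ccontr)
    assume "\<not> 0 < d"
    then have "u = 0\<^sub>v n" if "u \<in> carrier_vec n" "\<forall>i<n. d \<le> i \<longrightarrow> u $ i = 0" for u :: "complex vec"
      using that by (intro eq_vecI) auto
    then have "W \<subseteq> {P *\<^sub>v 0\<^sub>v n}"
      unfolding W_eq by auto
    moreover have "P *\<^sub>v 0\<^sub>v n \<in> W"
      unfolding W_eq by (intro CollectI exI[of _ "0\<^sub>v n"]) auto
    moreover have "P *\<^sub>v 0\<^sub>v n = 0\<^sub>v n"
      using P by (intro eq_vecI) auto
    ultimately show False using W(2) by auto
  qed
  have d_less: "d < n"
  proof (rule ccontr)
    assume "\<not> d < n"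
    then have "W = {P *\<^sub>v u | u. u \<in> carrier_vec n}"
      unfolding W_eq by auto
    also have "\<dots> = carrier_vec n"
    proof (intro equalityI subsetI)
      fix w :: "complex vec" assume w: "w \<in> carrier_vec n"
      then have "w = P *\<^sub>v (Q *\<^sub>v w)"
        using P Q PQ by (simp flip: assoc_mult_mat_vec)
      then show "w \<in> {P *\<^sub>v u | u. u \<in> carrier_vec n}"
        using Q w by auto
    qed (use P in auto)
    finally show False using W(3) by simp
  qed
  define \<sigma> where "\<sigma> g = Q * (\<rho> g * P)" for g
  have \<sigma>_carr: "\<sigma> g \<in> carrier_mat n n" if "g \<in> carrier G" for g
    using that P Q by (auto simp: \<sigma>_def)
  have \<sigma>_mult: "\<sigma> (g \<otimes> h) = \<sigma> g * \<sigma> h" if g: "g \<in> carrier G" and h: "h \<in> carrier G" for g h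
  proof -
    have "\<sigma> g * \<sigma> h = Q * (\<rho> g * (P * (Q * (\<rho> h * P))))"
      using g h P Q by (simp add: \<sigma>_def assoc_mult_mat[of _ n n _ n _ n] mult_carrier_mat[of _ n n])
    also have "P * (Q * (\<rho> h * P)) = (P * Q) * (\<rho> h * P)"
      by (rule assoc_mult_mat[symmetric, OF P Q]) (use h P in auto)
    also have "\<dots> = \<rho> h * P"
      using PQ h P by simp
    finally show ?thesis
      using g h P Q by (simp add: \<sigma>_def mult assoc_mult_mat[of _ n n _ n _ n] mult_carrier_mat[of _ n n])
  qed
  have \<sigma>_one: "\<sigma> \<one> = 1\<^sub>m n"
    using P QP by (simp add: \<sigma>_def one)
  have \<sigma>_trace: "(\<Sum>i<n. \<sigma> g $$ (i, i)) = mat_trace (\<rho> g)" if g: "g \<in> carrier G" for g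
  proof -
    have "(\<Sum>i<n. \<sigma> g $$ (i, i)) = (\<Sum>i<n. \<Sum>k<n. (\<rho> g * P) $$ (k, i) * Q $$ (i, k))"
      using g P Q by (simp add: \<sigma>_def scalar_prod_def atLeast0LessThan mult.commute)
    also have "\<dots> = (\<Sum>k<n. \<Sum>i<n. (\<rho> g * P) $$ (k, i) * Q $$ (i, k))"
      by (rule sum.swap)
    also have "\<dots> = (\<Sum>k<n. ((\<rho> g * P) * Q) $$ (k, k))"
      using g P Q by (simp add: scalar_prod_def atLeast0LessThan)
    also have "(\<rho> g * P) * Q = \<rho> g"
      using g P Q PQ by (simp add: assoc_mult_mat[of _ n n _ n _ n] right_mult_one_mat[of _ n n])
    finally show ?thesis
      using g by (simp add: trace_eq)
  qed
  \<comment> \<open>For \<open>j < d\<close> the column \<open>P *\<^sub>v unit_vec n j\<close> lies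
    in \<open>W\<close>, and \<open>\<rho> g\<close> maps it into \<open>W\<close>; the coordinates
    of the image from \<open>d\<close> on are therefore 0.\<close>
  have block: "\<sigma> g $$ (i, j) = 0" if g: "g \<in> carrier G" and ij: "d \<le> i" "i < n" "j < d" for g i j
  proof -
    have "P *\<^sub>v unit_vec n j \<in> W"
      unfolding W_eq using ij by (auto intro!: exI[of _ "unit_vec n j"])
    then have "\<rho> g *\<^sub>v (P *\<^sub>v unit_vec n j) \<in> W"
      using W(1) g by (auto simp: invariant_subspace_def)
    then obtain u where u: "\<rho> g *\<^sub>v (P *\<^sub>v unit_vec n j) = P *\<^sub>v u" "u \<in> carrier_vec n" "u $ i = 0"
      unfolding W_eq using ij by auto
    have "\<sigma> g *\<^sub>v unit_vec n j = Q *\<^sub>v (P *\<^sub>v u)"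
      using g P Q u(1)
      by (simp add: \<sigma>_def assoc_mult_mat_vec[of _ n n _ n] mult_carrier_mat[of _ n n])
    also have "\<dots> = (Q * P) *\<^sub>v u"
      using P Q u(2) by (simp add: assoc_mult_mat_vec[of _ n n _ n])
    also have "\<dots> = u"
      using QP u(2) by simp
    finally have "(\<sigma> g *\<^sub>v unit_vec n j) $ i = 0"
      using u(3) by simp
    then show ?thesis
      using \<sigma>_carr[OF g] ij d_less by simp
  qed
  \<comment> \<open>On each diagonal block one of the two sums vanishes: for \<open>A\<close> the
    second, where \<open>\<sigma> h\<close> has row at least \<open>d\<close> and column below
    \<open>d\<close>, and for \<open>D\<close> the first, where \<open>\<sigma> g\<close> has such a
    position.\<close>
  have \<sigma>_mult_index: "\<sigma> (g \<otimes> h) $$ (i, j) =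
      (\<Sum>k<d. \<sigma> g $$ (i, k) * \<sigma> h $$ (k, j)) + (\<Sum>k<n - d. \<sigma> g $$ (i, k + d) * \<sigma> h $$ (k + d, j))"
    if "g \<in> carrier G" "h \<in> carrier G" "i < n" "j < n" for g h i j
  proof -
    have "\<sigma> (g \<otimes> h) $$ (i, j) = (\<Sum>k<n. \<sigma> g $$ (i, k) * \<sigma> h $$ (k, j))"
      using that \<sigma>_carr[of g] \<sigma>_carr[of h] by (simp add: \<sigma>_mult scalar_prod_def atLeast0LessThan)
    then show ?thesis
      using d_less by (simp add: sum_lessThan_split[of d n])
  qed
  define A where "A g = mat d d (\<lambda>(i, j). \<sigma> g $$ (i, j))" for g
  define D where "D g = mat (n - d) (n - d) (\<lambda>(i, j). \<sigma> g $$ (i + d, j + d))" for g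
  have "A \<in> hom G (GL_complex d)"
  proof (rule hom_GL_complexI[OF is_group])
    fix g h assume gh: "g \<in> carrier G" "h \<in> carrier G"
    show "A (g \<otimes> h) = A g * A h"
    proof (rule eq_matI)
      fix i j assume "i < dim_row (A g * A h)" "j < dim_col (A g * A h)"
      then have "i < d" "j < d" by (auto simp: A_def)
      then show "A (g \<otimes> h) $$ (i, j) = (A g * A h) $$ (i, j)"
        using gh d_less by (simp add: A_def \<sigma>_mult_index block scalar_prod_def atLeast0LessThan)
    qed (auto simp: A_def)
  qed (use d_less in \<open>auto simp: A_def \<sigma>_one intro!: eq_matI\<close>)
  moreover have "D \<in> hom G (GL_complex (n - d))"
  proof (rule hom_GL_complexI[OF is_group])
    fix g h assume gh: "g \<in> carrier G" "h \<in> carrier G"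
    show "D (g \<otimes> h) = D g * D h"
    proof (rule eq_matI)
      fix i j assume "i < dim_row (D g * D h)" "j < dim_col (D g * D h)"
      then have "i < n - d" "j < n - d" by (auto simp: D_def)
      then show "D (g \<otimes> h) $$ (i, j) = (D g * D h) $$ (i, j)"
        using gh d_less by (simp add: D_def \<sigma>_mult_index block scalar_prod_def atLeast0LessThan)
    qed (auto simp: D_def)
  qed (use d_less in \<open>auto simp: D_def \<sigma>_one intro!: eq_matI\<close>)
  moreover have "mat_trace (\<rho> g) = mat_trace (A g) + mat_trace (D g)" if "g \<in> carrier G" for g
    unfolding \<sigma>_trace[OF that, symmetric]
    using d_less by (simp add: A_def D_def mat_trace_def sum_lessThan_split[of d n])
  ultimately show thesis using that d_pos d_less by blast
qed

text \<open>Strong induction on the degree replaces a decomposition into irreducibles, since the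
  trace of a reducible representation is the sum of two of smaller positive degree. Degree 0 is
  excluded from irreducibility, but its trace is an empty sum.\<close>

lemma (in group) sum_trace_eq_0_if_irreducible:
  assumes fin: "finite (carrier G)"
    and irr: "\<And>n \<rho>. irreducible_representation G n \<rho> \<Longrightarrow>
      (\<Sum>g\<in>carrier G. e g * mat_trace (\<rho> g)) = 0"
    and hom: "\<rho> \<in> hom G (GL_complex n)"
  shows "(\<Sum>g\<in>carrier G. e g * mat_trace (\<rho> g)) = 0"
  using hom
proof (induction n arbitrary: \<rho> rule: less_induct)
  case (less n)
  interpret matrix_representation G n \<rho>
    by unfold_locales (use fin less.prems in auto)
  show ?case
  proof (cases "n = 0 \<or> irreducible_representation G n \<rho>")
    case True
    then show ?thesis
    proof
      assume "n = 0"
      then show ?thesis by (simp add: trace_eq)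
    qed (rule irr)
  next
    case False
    then obtain d A D where "d < n" "0 < d" "A \<in> hom G (GL_complex d)" "D \<in> hom G (GL_complex (n - d))"
      and tr: "\<And>g. g \<in> carrier G \<Longrightarrow> mat_trace (\<rho> g) = mat_trace (A g) + mat_trace (D g)"
      using reducible_trace by blast
    then have "(\<Sum>g\<in>carrier G. e g * mat_trace (A g)) = 0" "(\<Sum>g\<in>carrier G. e g * mat_trace (D g)) = 0"
      using less.IH[of d A] less.IH[of "n - d" D] by auto
    then show ?thesis
      by (simp add: tr distrib_left sum.distrib)
  qed
qed

text \<open>The regular representation has trace \<open>|G|\<close> at the identity and 0 elsewhere,
  so pairing it with the translate \<open>y \<mapsto> f (y \<otimes> x)\<close> isolates
  \<open>f x\<close>.\<close>

lemma (in group) function_eq_0_if_irreducible_traces: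
  fixes f :: "'a \<Rightarrow> complex"
  assumes fin: "finite (carrier G)"
    and irr: "\<And>n \<rho> h. irreducible_representation G n \<rho> \<Longrightarrow> h \<in> carrier G \<Longrightarrow>
      (\<Sum>g\<in>carrier G. f g * mat_trace (\<rho> (g \<otimes> h))) = 0"
    and x: "x \<in> carrier G"
  shows "f x = 0"
proof -
  define N where "N = card (carrier G)"
  obtain e where e: "bij_betw e {..<N} (carrier G)"
    using ex_bij_betw_nat_finite[OF fin] by (auto simp: N_def atLeast0LessThan)
  have e_carr: "e i \<in> carrier G" if "i < N" for i
    using e that by (auto simp: bij_betw_def)
  have e_inj: "e i = e j \<longleftrightarrow> i = j" if "i < N" "j < N" for i j
    using e that by (auto simp: bij_betw_def inj_on_def)
  \<comment> \<open>This is left multiplication by \<open>g\<close> as a permutation matrix, with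
    rows and columns numbered through \<open>e\<close>.\<close>
  define \<rho> where "\<rho> g = mat N N (\<lambda>(i, j). if g \<otimes> e j = e i then 1 else 0 :: complex)" for g
  have hom: "\<rho> \<in> hom G (GL_complex N)"
  proof (rule hom_GL_complexI[OF is_group])
    fix g h assume gh: "g \<in> carrier G" "h \<in> carrier G"
    show "\<rho> (g \<otimes> h) = \<rho> g * \<rho> h"
    proof (rule eq_matI)
      fix i j assume "i < dim_row (\<rho> g * \<rho> h)" "j < dim_col (\<rho> g * \<rho> h)"
      then have ij: "i < N" "j < N" by (auto simp: \<rho>_def)
      \<comment> \<open>The summand is written as a function of \<open>e k\<close> so that the sum
        can be moved to the group, where only \<open>y = h \<otimes> e j\<close>
        contributes.\<close>
      have "(\<rho> g * \<rho> h) $$ (i, j) =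
          (\<Sum>k<N. (\<lambda>y. if h \<otimes> e j = y then (if g \<otimes> y = e i then 1 else 0) else 0) (e k))"
        using ij by (auto simp: \<rho>_def scalar_prod_def atLeast0LessThan intro!: sum.cong)
      also have "\<dots> = (\<Sum>y\<in>carrier G. if h \<otimes> e j = y then (if g \<otimes> y = e i then 1 else 0) else 0)"
        by (rule sum.reindex_bij_betw[OF e])
      also have "\<dots> = (if g \<otimes> (h \<otimes> e j) = e i then 1 else 0)"
        using gh ij e_carr fin by (simp add: sum.delta')
      also have "\<dots> = \<rho> (g \<otimes> h) $$ (i, j)"
        using gh ij e_carr by (simp add: \<rho>_def m_assoc)
      finally show "\<rho> (g \<otimes> h) $$ (i, j) = (\<rho> g * \<rho> h) $$ (i, j)" ..
    qed (auto simp: \<rho>_def)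
  qed (auto simp: \<rho>_def e_carr e_inj intro!: eq_matI)
  have tr: "mat_trace (\<rho> g) = (if \<one> = g then of_nat N else 0)" if g: "g \<in> carrier G" for g
  proof -
    have "g \<otimes> e i = e i \<longleftrightarrow> \<one> = g" if "i < N" for i
      using g e_carr[OF that] by (auto simp: eq_commute[of \<one> g])
    then show ?thesis
      by (simp add: mat_trace_def \<rho>_def)
  qed
  have "(\<Sum>y\<in>carrier G. f (y \<otimes> x) * mat_trace (\<rho> y)) = 0"
  proof (rule sum_trace_eq_0_if_irreducible[OF fin _ hom])
    fix n \<sigma> assume \<sigma>: "irreducible_representation G n \<sigma>"
    \<comment> \<open>Writing \<open>y\<close> as \<open>y \<otimes> x \<otimes> inv x\<close> makes
      the summand a function of \<open>y \<otimes> x\<close>; the hypothesis on irreducibles is then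
      used with \<open>h = inv x\<close>.\<close>
    have "(\<Sum>y\<in>carrier G. f (y \<otimes> x) * mat_trace (\<sigma> y)) =
        (\<Sum>y\<in>carrier G. f (y \<otimes> x) * mat_trace (\<sigma> (y \<otimes> x \<otimes> inv x)))"
      using x by (intro sum.cong refl) (simp add: m_assoc)
    also have "\<dots> = (\<Sum>g\<in>carrier G. f g * mat_trace (\<sigma> (g \<otimes> inv x)))"
      by (rule sum_carrier_right_mult[OF x])
    also have "\<dots> = 0"
      using irr[OF \<sigma>] x by simp
    finally show "(\<Sum>y\<in>carrier G. f (y \<otimes> x) * mat_trace (\<sigma> y)) = 0" .
  qed
  moreover have "(\<Sum>y\<in>carrier G. f (y \<otimes> x) * mat_trace (\<rho> y)) =
      (\<Sum>y\<in>carrier G. if \<one> = y then f (y \<otimes> x) * of_nat N else 0)"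
    by (intro sum.cong refl) (simp add: tr)
  moreover have "\<dots> = f x * of_nat N"
    using x fin by (simp add: sum.delta')
  ultimately show ?thesis
    using fin x by (auto simp: N_def)
qed

subsection \<open>Commutator counts in groups with two character degrees\<close>

lemma (in group) character_degreesI:
  assumes "irreducible_representation G n \<rho>"
  shows "of_nat n \<in> character_degrees G"
proof -
  have "\<rho> \<one> = 1\<^sub>m n"
    using assms by (intro hom_GL_complex_one) (simp add: irreducible_representation_def)
  then have "of_nat n = (\<lambda>g\<in>carrier G. mat_trace (\<rho> g)) \<one>"
    by (simp add: mat_trace_def)
  then show ?thesis
    unfolding character_degrees_def irreducible_characters_def using assms by blast
qed

lemma (in group) character_degreesE:
  assumes "x \<in> character_degrees G" "finite (carrier G)"
  obtains n \<rho> where "irreducible_matrix_representation G n \<rho>" "x = of_nat n"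
proof -
  obtain n \<rho> where irr: "irreducible_representation G n \<rho>" and x: "x = mat_trace (\<rho> \<one>)"
    using assms(1) by (auto simp: character_degrees_def irreducible_characters_def)
  interpret irreducible_matrix_representation G n \<rho>
    by unfold_locales (use irr assms(2) in \<open>auto simp: irreducible_representation_def\<close>)
  have "x = of_nat n"
    by (simp add: x one mat_trace_def)
  then show thesis using that irreducible_matrix_representation_axioms by blast
qed

text \<open>An irreducible representation of degree other than 1 is not trivial on
  \<open>G'\<close>. This supplies the non-identity element at which the second value of the count
  is attained.\<close>

lemma (in group) derived_nontrivial:
  assumes fin: "finite (carrier G)" and "of_nat m \<in> character_degrees G" "m \<noteq> 1"
  shows "derived G (carrier G) \<noteq> {\<one>}"
proof
  assume triv: "derived G (carrier G) = {\<one>}"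
  obtain n \<rho> where "irreducible_matrix_representation G n \<rho>" and n: "n = m"
    using character_degreesE[OF assms(2) fin] by (metis of_nat_eq_iff)
  then interpret irreducible_matrix_representation G n \<rho> by simp
  show False
    using trivial_on_derived_iff assms(3) by (simp add: triv one n)
qed

text \<open>On the irreducible representations of degree \<open>d\<close> the element
  \<open>\<Sum>g. commutator_word_count G k g * g\<close> of the group algebra acts as the scalar \<open>(|G| / d) ^ (2 * k)\<close>,
  while the sum over the derived subgroup acts as its order for \<open>d = 1\<close> and as 0 otherwise. Hence
  the right-hand side is the only combination of the derived subgroup and the unit element that acts
  in the same way in degrees 1 and \<open>m\<close>.\<close>

lemma (in group) commutator_word_count_eq:
  assumes fin: "finite (carrier G)"
    and cd: "character_degrees G = {1, of_nat m}" and m: "1 < m"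
    and g: "g \<in> derived G (carrier G)"
  shows "real (commutator_word_count G k g) =
    real (card (carrier G)) ^ (2 * k) * (1 - 1 / real m ^ (2 * k)) / real (card (derived G (carrier G))) +
    (if g = \<one> then (real (card (carrier G)) / real m) ^ (2 * k) else 0)"
proof -
  define D where "D = derived G (carrier G)"
  define c :: complex where "c = of_nat (card (carrier G)) ^ (2 * k) * (1 - 1 / of_nat m ^ (2 * k)) / of_nat (card D)"
  define b :: complex where "b = (of_nat (card (carrier G)) / of_nat m) ^ (2 * k)"
  \<comment> \<open>The claimed formula is extended by 0 off \<open>G'\<close>, because the
    vanishing criterion sums over the whole group.\<close>
  define f where "f x = of_nat (commutator_word_count G k x) -
    ((if x \<in> D then c else 0) + (if \<one> = x then b else 0))" for x
  have subD: "subgroup D G"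
    unfolding D_def by (rule derived_is_subgroup) simp
  then have D: "D \<subseteq> carrier G" "\<one> \<in> D" by (auto simp: subgroup.subset subgroup.one_closed)
  have cardD: "card D \<noteq> 0"
    using D finite_subset[OF D(1) fin] by auto
  have "f g = 0"
  proof (rule function_eq_0_if_irreducible_traces[OF fin])
    fix n \<rho> h assume irr: "irreducible_representation G n \<rho>" and h: "h \<in> carrier G"
    interpret irreducible_matrix_representation G n \<rho>
      by unfold_locales (use irr fin in \<open>auto simp: irreducible_representation_def\<close>)
    have "complex_of_nat n = of_nat 1 \<or> complex_of_nat n = of_nat m"
      using character_degreesI[OF irr] by (simp add: cd)
    then have "n = 1 \<or> n = m"
      by (simp only: of_nat_eq_iff)
    define T where "T x = mat_trace (\<rho> (x \<otimes> h))" for x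
    have "(\<Sum>x\<in>carrier G. of_nat (commutator_word_count G k x) * T x) =
        (\<Sum>ps\<in>pair_tuples G k. \<Sum>i<n. \<rho> (commutator_product G ps \<otimes> h) $$ (i, i))"
      unfolding sum_commutator_word_count[OF fin] T_def
      using h commutator_product_closed by (intro sum.cong refl) (simp add: trace_eq)
    also have "\<dots> = (\<Sum>i<n. \<Sum>ps\<in>pair_tuples G k. \<rho> (commutator_product G ps \<otimes> h) $$ (i, i))"
      by (rule sum.swap)
    also have "\<dots> = (of_nat (card (carrier G)) / of_nat n) ^ (2 * k) * T \<one>"
      using h by (simp add: sum_commutator_product_index T_def trace_eq sum_distrib_left)
    finally have 1: "(\<Sum>x\<in>carrier G. of_nat (commutator_word_count G k x) * T x) =
        (of_nat (card (carrier G)) / of_nat n) ^ (2 * k) * T \<one>" .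
    have "(\<Sum>x\<in>D. T x) = (\<Sum>x\<in>D. \<Sum>i<n. \<rho> (x \<otimes> h) $$ (i, i))"
      using h D by (intro sum.cong refl) (auto simp: T_def trace_eq)
    also have "\<dots> = (\<Sum>i<n. \<Sum>x\<in>D. \<rho> (x \<otimes> h) $$ (i, i))"
      by (rule sum.swap)
    also have "\<dots> = (if n = 1 then of_nat (card D) * T \<one> else 0)"
      using h by (simp add: sum_derived_index D_def T_def trace_eq sum_distrib_left)
    finally have 2: "(\<Sum>x\<in>D. T x) = (if n = 1 then of_nat (card D) * T \<one> else 0)" .
    have "(\<Sum>x\<in>carrier G. (if x \<in> D then c else 0) * T x) = (\<Sum>x\<in>carrier G \<inter> D. c * T x)"
      unfolding sum.inter_restrict[OF fin] by (intro sum.cong refl) auto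
    also have "carrier G \<inter> D = D" using D by auto
    finally have 3: "(\<Sum>x\<in>carrier G. (if x \<in> D then c else 0) * T x) = c * (\<Sum>x\<in>D. T x)"
      by (simp add: sum_distrib_left)
    have "(\<Sum>x\<in>carrier G. (if \<one> = x then b else 0) * T x) = (\<Sum>x\<in>carrier G. if \<one> = x then b * T x else 0)"
      by (intro sum.cong refl) auto
    then have 4: "(\<Sum>x\<in>carrier G. (if \<one> = x then b else 0) * T x) = b * T \<one>"
      using fin by (simp add: sum.delta')
    have "(\<Sum>x\<in>carrier G. f x * T x) =
        (of_nat (card (carrier G)) / of_nat n) ^ (2 * k) * T \<one> -
        (c * (if n = 1 then of_nat (card D) * T \<one> else 0) + b * T \<one>)"
      unfolding f_def left_diff_distrib distrib_right sum_subtractf sum.distrib 1 2 3 4 ..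
    \<comment> \<open>The coefficient of \<open>T \<one>\<close> is
      \<open>|G|^(2k) - c |D| - b\<close> in degree 1 and \<open>(|G|/m)^(2k) - b\<close> in degree
      \<open>m\<close>; both vanish by the choice of \<open>c\<close> and \<open>b\<close>.\<close>
    also have "\<dots> = 0"
      using \<open>n = 1 \<or> n = m\<close> m cardD
      by (auto simp: c_def b_def power_divide field_simps)
    finally show "(\<Sum>x\<in>carrier G. f x * mat_trace (\<rho> (x \<otimes> h))) = 0"
      by (simp add: T_def)
  qed (use g D in \<open>auto simp: D_def\<close>)
  then have "complex_of_real (real (commutator_word_count G k g)) = complex_of_real (
      real (card (carrier G)) ^ (2 * k) * (1 - 1 / real m ^ (2 * k)) / real (card D) +
      (if g = \<one> then (real (card (carrier G)) / real m) ^ (2 * k) else 0))"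
    using g by (simp add: f_def c_def b_def flip: D_def)
  then show ?thesis
    unfolding of_real_eq_iff D_def .
qed

subsection \<open>Groups of prime power order are not perfect\<close>

text \<open>This is the class equation: if only the identity were central, every other conjugacy
  class would have size a positive power of \<open>p\<close>, and \<open>|G|\<close> would be 1
  modulo \<open>p\<close> although \<open>p\<close> divides it.\<close>

lemma (in group) p_group_center_nontrivial:
  fixes p :: nat
  assumes fin: "finite (carrier G)" and p: "Factorial_Ring.prime p"
    and card: "card (carrier G) = p ^ a" and nontriv: "carrier G \<noteq> {\<one>}"
  shows "\<exists>z\<in>carrier G. z \<noteq> \<one> \<and> (\<forall>x\<in>carrier G. x \<otimes> z = z \<otimes> x)"
proof (rule ccontr)
  assume no_z: "\<not> ?thesis"
  have no_center: "\<exists>x\<in>carrier G. x \<otimes> z \<noteq> z \<otimes> x" if "z \<in> carrier G" "z \<noteq> \<one>" for z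
    using that no_z by blast
  define \<phi> where "\<phi> = (\<lambda>g. \<lambda>h\<in>carrier G. g \<otimes> h \<otimes> inv g)"
  interpret group_action G "carrier G" \<phi>
    unfolding \<phi>_def by (rule action_by_conjugation)
  have orbit_eq: "orbit G \<phi> x = {g \<otimes> x \<otimes> inv g | g. g \<in> carrier G}" if "x \<in> carrier G" for x
    using that by (auto simp: orbit_def \<phi>_def)
  have orbit_one: "orbit G \<phi> \<one> = {\<one>}"
    by (auto simp: orbit_eq intro!: exI[of _ \<one>])
  have p_dvd_orbit: "p dvd card (orbit G \<phi> x)" if x: "x \<in> carrier G" "x \<noteq> \<one>" for x
  proof -
    have "card (orbit G \<phi> x) dvd p ^ a"
      using orbit_stabilizer_theorem[OF x(1)] card by (metis dvd_triv_left Coset.order_def)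
    then obtain i where i: "card (orbit G \<phi> x) = p ^ i"
      using p divides_primepow_nat by auto
    \<comment> \<open>A one-element class would make \<open>x\<close> central, against the
      assumption.\<close>
    have "i \<noteq> 0"
    proof
      assume "i = 0"
      then obtain y where y: "orbit G \<phi> x = {y}"
        using i by (auto simp: card_1_singleton_iff)
      have "g \<otimes> x = x \<otimes> g" if g: "g \<in> carrier G" for g
      proof -
        have "\<one> \<otimes> x \<otimes> inv \<one> = y" "g \<otimes> x \<otimes> inv g = y"
          using y g x unfolding orbit_eq[OF x(1)] by blast+
        then have "g \<otimes> x \<otimes> inv g = x" using x by simp
        then show ?thesis
          using g x(1) by (metis inv_solve_right m_closed)
      qed
      then show False using no_center[OF x] by blast
    qed
    then show ?thesis using i by simp
  qed
  have fin_orbits: "finite (orbits G (carrier G) \<phi>)"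
    using fin by (simp add: orbits_def)
  have one_orbit: "{\<one>} \<in> orbits G (carrier G) \<phi>"
    unfolding orbits_def using orbit_one by (intro CollectI exI[of _ \<one>]) simp
  have "card (carrier G) = (\<Sum>X\<in>orbits G (carrier G) \<phi>. card X)"
    using disjoint_sum[OF fin, of "\<lambda>_. 1 :: nat"] by simp
  also have "\<dots> = 1 + (\<Sum>X\<in>orbits G (carrier G) \<phi> - {{\<one>}}. card X)"
    using sum.remove[OF fin_orbits one_orbit, of card] by simp
  finally have "card (carrier G) = 1 + (\<Sum>X\<in>orbits G (carrier G) \<phi> - {{\<one>}}. card X)" .
  moreover have "p dvd (\<Sum>X\<in>orbits G (carrier G) \<phi> - {{\<one>}}. card X)"
    using p_dvd_orbit orbit_one by (intro dvd_sum) (auto simp: orbits_def)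
  moreover have "p dvd card (carrier G)"
  proof -
    have "a \<noteq> 0"
    proof
      assume "a = 0"
      then obtain y where "carrier G = {y}"
        using card by (auto simp: card_1_singleton_iff)
      then show False using nontriv one_closed by auto
    qed
    then show ?thesis using card by simp
  qed
  ultimately have "p dvd 1"
    by (metis dvd_add_left_iff)
  then show False
    using p by simp
qed

lemma (in group) center_subgroup:
  "subgroup {z \<in> carrier G. \<forall>x\<in>carrier G. x \<otimes> z = z \<otimes> x} G" (is "subgroup ?Z G")
proof (rule subgroupI)
  fix y z assume "y \<in> ?Z" "z \<in> ?Z"
  then have yz: "y \<in> carrier G" "z \<in> carrier G"
    and comm: "\<And>x. x \<in> carrier G \<Longrightarrow> x \<otimes> y = y \<otimes> x" "\<And>x. x \<in> carrier G \<Longrightarrow> x \<otimes> z = z \<otimes> x"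
    by blast+
  have "x \<otimes> (y \<otimes> z) = y \<otimes> z \<otimes> x" if x: "x \<in> carrier G" for x
  proof -
    have "x \<otimes> (y \<otimes> z) = y \<otimes> x \<otimes> z"
      using x yz by (simp only: comm(1)[OF x, symmetric] m_assoc)
    also have "\<dots> = y \<otimes> (z \<otimes> x)"
      using x yz by (simp only: comm(2)[OF x, symmetric] m_assoc)
    finally show ?thesis
      using x yz by (simp only: m_assoc)
  qed
  then show "y \<otimes> z \<in> ?Z"
    using yz by blast
next
  fix z assume "z \<in> ?Z"
  then have z: "z \<in> carrier G" and comm: "\<And>x. x \<in> carrier G \<Longrightarrow> x \<otimes> z = z \<otimes> x"
    by blast+
  have "x \<otimes> inv z = inv z \<otimes> x" if x: "x \<in> carrier G" for x
  proof -
    have "inv (z \<otimes> inv x) = inv (inv x \<otimes> z)"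
      by (simp only: comm[OF inv_closed[OF x]])
    then show ?thesis
      using z x by (simp only: inv_mult_group inv_closed inv_inv)
  qed
  then show "inv z \<in> ?Z"
    using z by blast
qed (auto intro: exI[of _ \<one>])

text \<open>For a maximal proper normal subgroup \<open>N\<close> the quotient is a nontrivial
  \<open>p\<close>-group, so its center is nontrivial. The preimage \<open>M\<close> of the center
  is normal and strictly larger than \<open>N\<close>, hence all of \<open>G\<close>; the quotient
  is therefore abelian and \<open>G'\<close> lies in \<open>N\<close>.\<close>

lemma (in group) p_group_not_perfect:
  fixes p :: nat
  assumes fin: "finite (carrier G)" and p: "Factorial_Ring.prime p"
    and card: "card (carrier G) = p ^ a" and nontriv: "carrier G \<noteq> {\<one>}"
  shows "derived G (carrier G) \<noteq> carrier G"
proof -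
  have "finite {N. N \<lhd> G \<and> N \<noteq> carrier G}"
    by (rule finite_subset[of _ "Pow (carrier G)"])
      (use fin in \<open>auto dest: normal_imp_subgroup subgroup.subset\<close>)
  moreover have "{\<one>} \<in> {N. N \<lhd> G \<and> N \<noteq> carrier G}"
    using nontriv one_is_normal by auto
  ultimately obtain N where N: "N \<lhd> G" "N \<noteq> carrier G"
    and max: "\<And>M. M \<lhd> G \<Longrightarrow> M \<noteq> carrier G \<Longrightarrow> N \<subseteq> M \<Longrightarrow> N = M"
    using finite_has_maximal[of "{N. N \<lhd> G \<and> N \<noteq> carrier G}"] by blast
  interpret N: normal N G by fact
  interpret Q: group "G Mod N" by (rule N.factorgroup_is_group)
  note mult_FactGroup [simp del]
  define \<pi> where "\<pi> x = N #> x" for x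
  have \<pi>_hom: "\<pi> \<in> hom G (G Mod N)"
    unfolding \<pi>_def by (rule N.r_coset_hom_Mod)
  interpret \<pi>: group_hom G "G Mod N" \<pi>
    by unfold_locales (rule \<pi>_hom)
  have \<pi>_surj: "carrier (G Mod N) = \<pi> ` carrier G"
    by (auto simp: FactGroup_def RCOSETS_def \<pi>_def)
  have \<pi>_one: "\<pi> x = \<one>\<^bsub>G Mod N\<^esub> \<longleftrightarrow> x \<in> N" if "x \<in> carrier G" for x
  proof -
    have "N #> x = N \<longleftrightarrow> x \<in> N"
      using coset_join1[of N x] coset_join2[of x N] that N.subgroup_axioms by blast
    then show ?thesis by (simp add: \<pi>_def FactGroup_def)
  qed
  have "card (carrier (G Mod N)) * card N = p ^ a"
    using lagrange[OF N.subgroup_axioms] card by (simp add: FactGroup_def Coset.order_def)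
  then have "card (carrier (G Mod N)) dvd p ^ a"
    by (metis dvd_triv_left)
  then obtain i where i: "card (carrier (G Mod N)) = p ^ i"
    using p divides_primepow_nat by auto
  obtain x where x: "x \<in> carrier G" "x \<notin> N"
    using N(2) N.subset by blast
  then have "\<pi> x \<in> carrier (G Mod N)" "\<pi> x \<noteq> \<one>\<^bsub>G Mod N\<^esub>"
    using \<pi>_one[OF x(1)] by simp_all
  then have nontriv_Q: "carrier (G Mod N) \<noteq> {\<one>\<^bsub>G Mod N\<^esub>}"
    by (metis singletonD)
  have fin_Q: "finite (carrier (G Mod N))"
    using fin by (simp add: \<pi>_surj)
  define C where "C = {Z \<in> carrier (G Mod N). \<forall>X\<in>carrier (G Mod N).
    X \<otimes>\<^bsub>G Mod N\<^esub> Z = Z \<otimes>\<^bsub>G Mod N\<^esub> X}"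
  interpret C: subgroup C "G Mod N"
    unfolding C_def by (rule Q.center_subgroup)
  obtain Z where Z: "Z \<in> carrier (G Mod N)" "Z \<noteq> \<one>\<^bsub>G Mod N\<^esub>" "Z \<in> C"
    using Q.p_group_center_nontrivial[OF fin_Q p i nontriv_Q] unfolding C_def by blast
  define M where "M = {x \<in> carrier G. \<pi> x \<in> C}"
  have "subgroup M G"
  proof (rule subgroupI)
    have "\<one> \<in> M" using C.one_closed by (simp add: M_def)
    then show "M \<noteq> {}" by blast
    show "x \<otimes> y \<in> M" if "x \<in> M" "y \<in> M" for x y
      using that C.m_closed by (simp add: M_def)
  qed (auto simp: M_def)
  moreover have "x \<otimes> h \<otimes> inv x \<in> M" if x: "x \<in> carrier G" and h: "h \<in> M" for x h
  proof -
    have hc: "h \<in> carrier G" "\<pi> h \<in> C" using h by (auto simp: M_def)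
    have "\<forall>X\<in>carrier (G Mod N). X \<otimes>\<^bsub>G Mod N\<^esub> \<pi> h = \<pi> h \<otimes>\<^bsub>G Mod N\<^esub> X"
      using hc(2) unfolding C_def by blast
    then have "\<pi> x \<otimes>\<^bsub>G Mod N\<^esub> \<pi> h = \<pi> h \<otimes>\<^bsub>G Mod N\<^esub> \<pi> x"
      using \<pi>.hom_closed[OF x] by blast
    then have "\<pi> (x \<otimes> h \<otimes> inv x) = \<pi> h"
      using x hc(1) by (simp add: Q.m_assoc del: one_FactGroup)
    then show ?thesis
      using x hc by (simp add: M_def)
  qed
  ultimately have "M \<lhd> G"
    by (simp add: normal_inv_iff)
  moreover have "N \<subseteq> M"
    using N.subset \<pi>_one C.one_closed by (auto simp: M_def)
  moreover have "N \<noteq> M"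
  proof -
    obtain z where "z \<in> carrier G" "Z = \<pi> z"
      using Z(1) \<pi>_surj by auto
    then have "z \<in> M" "z \<notin> N"
      using Z \<pi>_one[of z] by (simp_all add: M_def)
    then show ?thesis by blast
  qed
  ultimately have "M = carrier G"
    using max by blast
  then have "carrier (G Mod N) \<subseteq> C"
    using \<pi>_surj by (auto simp: M_def)
  then have "comm_group (G Mod N)"
    unfolding C_def by (intro Q.group_comm_groupI) blast
  then have "derived G (carrier G) \<subseteq> N"
    by (rule derived_minimal[OF N(1)])
  then show ?thesis
    using N(2) N.subset by blast
qed

section \<open>The index of the derived subgroup, the lower bound and the two values\<close>

theorem theoremC:
  fixes G :: "('a, 'b) monoid_scheme" and p m k :: nat
  assumes "Factorial_Ring.prime p"
    and "group G"
    and "finite (carrier G)"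
    and "\<exists>n. Coset.order G = p ^ n"
    and "character_degrees G = {1, of_nat m}"
    and "m > 1"
    and "k \<ge> 1"
  shows "derived G (carrier G) = commutator_word_values G k \<and>
    card {commutator_word_count G k g | g. g \<in> derived G (carrier G)} = 2 \<and>
    (\<forall>g \<in> derived G (carrier G). commutator_word_count G k g \<ge> Coset.order G ^ (2 * k - 1))"
proof -
  interpret group G by fact
  note fin = \<open>finite (carrier G)\<close>
  obtain a where card: "card (carrier G) = p ^ a"
    using assms(4) by (auto simp: Coset.order_def)
  define D where "D = derived G (carrier G)"
  define N where "N g = commutator_word_count G k g" for g
  define c where "c = real (card (carrier G)) ^ (2 * k) * (1 - 1 / real m ^ (2 * k)) / real (card D)"
  define b where "b = (real (card (carrier G)) / real m) ^ (2 * k)"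
  have subD: "subgroup D G"
    unfolding D_def by (rule derived_is_subgroup) simp
  then have D: "D \<subseteq> carrier G" "\<one>\<^bsub>G\<^esub> \<in> D"
    by (auto simp: subgroup.subset subgroup.one_closed)
  have N_eq: "real (N g) = c + (if g = \<one>\<^bsub>G\<^esub> then b else 0)" if "g \<in> D" for g
    using commutator_word_count_eq[OF fin assms(5,6), of g k] that
    by (simp add: D_def N_def c_def b_def)
  have "of_nat m \<in> character_degrees G" "m \<noteq> 1"
    using assms(5,6) by auto
  then have D_nontriv: "D \<noteq> {\<one>\<^bsub>G\<^esub>}"
    unfolding D_def by (rule derived_nontrivial[OF fin])
  have "carrier G \<noteq> {\<one>\<^bsub>G\<^esub>}"
    using D D_nontriv by auto
  then have D_proper: "D \<noteq> carrier G"
    unfolding D_def by (rule p_group_not_perfect[OF fin assms(1) card])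
  have card_pos: "0 < card (carrier G)" "0 < card D"
    using fin D finite_subset[OF D(1) fin] by (auto simp: card_gt_0_iff)
  \<comment> \<open>By Lagrange the index of \<open>G'\<close> is a positive integer, and it is not
    1 because \<open>G'\<close> is proper.\<close>
  have index: "2 * card D \<le> card (carrier G)"
  proof -
    have lagr: "card (rcosets\<^bsub>G\<^esub> D) * card D = card (carrier G)"
      using lagrange[OF subD] by (simp add: Coset.order_def)
    have "card (rcosets\<^bsub>G\<^esub> D) \<noteq> 1"
      using lagr D_proper card_subset_eq[OF fin D(1)] by auto
    moreover have "card (rcosets\<^bsub>G\<^esub> D) \<noteq> 0"
      using lagr card_pos by (metis mult_zero_left less_irrefl)
    ultimately have "2 \<le> card (rcosets\<^bsub>G\<^esub> D)" by simp
    then show ?thesis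
      using mult_le_mono1[of 2 _ "card D"] lagr by metis
  qed
  \<comment> \<open>\<open>c\<close> is \<open>|G|^(2k-1)\<close> times \<open>|G|/|G'|\<close>
    times \<open>1 - m^(-2k)\<close>, and the last two factors are at least 2 and 1/2. Since
    \<open>k \<ge> 1\<close>, the subtraction in \<open>2 * k - 1\<close> is not truncated.\<close>
  have c_ge: "real (card (carrier G)) ^ (2 * k - 1) \<le> c"
  proof -
    have "2 \<le> real m ^ 1"
      using assms(6) by simp
    also have "\<dots> \<le> real m ^ (2 * k)"
      using assms(6,7) by (intro power_increasing) auto
    finally have "1 / real m ^ (2 * k) \<le> 1 / 2"
      by (intro frac_le) auto
    then have "1 / 2 \<le> 1 - 1 / real m ^ (2 * k)"
      by linarith
    moreover have "real (2 * card D) \<le> real (card (carrier G))"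
      using index by (simp only: of_nat_le_iff)
    then have "2 \<le> real (card (carrier G)) / real (card D)"
      using card_pos by (simp add: pos_le_divide_eq)
    ultimately have "2 * (1 / 2) \<le> real (card (carrier G)) / real (card D) * (1 - 1 / real m ^ (2 * k))"
      by (intro mult_mono) auto
    then have "real (card (carrier G)) ^ (2 * k - 1) * 1 \<le> real (card (carrier G)) ^ (2 * k - 1) *
        (real (card (carrier G)) / real (card D) * (1 - 1 / real m ^ (2 * k)))"
      by (intro mult_left_mono) auto
    also have "\<dots> = c"
    proof -
      have "real (card (carrier G)) ^ (2 * k) = real (card (carrier G)) ^ (2 * k - 1) * real (card (carrier G))"
        using assms(7) by (simp flip: power_Suc2)
      then show ?thesis by (simp add: c_def)
    qed
    finally show ?thesis by simp
  qed
  have b_pos: "0 < b"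
    using card_pos assms(6) by (simp add: b_def)
  have N_ge: "card (carrier G) ^ (2 * k - 1) \<le> N g" if "g \<in> D" for g
  proof -
    have "real (card (carrier G) ^ (2 * k - 1)) \<le> real (N g)"
      using c_ge b_pos N_eq[OF that] by auto
    then show ?thesis by (simp only: of_nat_le_iff)
  qed
  \<comment> \<open>A positive count means that a tuple exists, so the lower bound already makes
    each element of \<open>G'\<close> a product of \<open>k\<close> commutators.\<close>
  have "D \<subseteq> commutator_word_values G k"
  proof
    fix g assume "g \<in> D"
    then have "N g \<noteq> 0"
      using N_ge[of g] card_pos by (metis le_zero_eq power_eq_0_iff less_irrefl)
    then show "g \<in> commutator_word_values G k"
      by (auto simp: N_def commutator_word_count_def commutator_word_values_def card_eq_0_iff)
  qed
  moreover have "commutator_word_values G k \<subseteq> D"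
    unfolding commutator_word_values_def D_def by (auto intro: commutator_product_in_derived)
  moreover have "card {N g | g. g \<in> D} = 2"
  proof -
    \<comment> \<open>The counts are \<open>c + b\<close> at the identity and \<open>c\<close> at
      \<open>g0\<close>; they differ because \<open>b\<close> is positive.\<close>
    obtain g0 where g0: "g0 \<in> D" "g0 \<noteq> \<one>\<^bsub>G\<^esub>"
      using D D_nontriv by auto
    have "N g = N g0" if "g \<in> D" "g \<noteq> \<one>\<^bsub>G\<^esub>" for g
      using N_eq[OF that(1)] N_eq[OF g0(1)] that(2) g0(2) by simp
    then have "N g \<in> {N \<one>\<^bsub>G\<^esub>, N g0}" if "g \<in> D" for g
      using that by blast
    then have "{N g | g. g \<in> D} = {N \<one>\<^bsub>G\<^esub>, N g0}"
      using g0(1) D(2) by blast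
    moreover have "N \<one>\<^bsub>G\<^esub> \<noteq> N g0"
    proof
      assume "N \<one>\<^bsub>G\<^esub> = N g0"
      then have "c + b = c"
        using N_eq[OF D(2)] N_eq[OF g0(1)] g0(2) by simp
      then show False using b_pos by simp
    qed
    ultimately show ?thesis by simp
  qed
  ultimately have "D = commutator_word_values G k \<and> card {N g | g. g \<in> D} = 2 \<and>
      (\<forall>g\<in>D. N g \<ge> card (carrier G) ^ (2 * k - 1))"
    using N_ge by (metis subset_antisym)
  then show ?thesis
    unfolding D_def N_def Coset.order_def .
qed

end
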